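(* Let $W:\mathcal{X}\to\mathcal{S}(B)$ be a cq-channel, and let $T=(T_y:y\in\mathcal{Y})$ be an informationally complete POVM on $B$ with $\infty>|\mathcal{Y}|\ge|B|^2$. Then for any $\lambda_1,\lambda_2>0$ with $\lambda_1+\lambda_2<1$, \[ \frac14\,\overline{d}_M\!\left(\sqrt{\widehat{\mathcal{X}}}\right)\;\le\;\dot{C}^{\mathrm{sim,opt}}_{\mathrm{DI}}(W)\;\le\;\limsup_{n\to\infty}\frac{1}{n\log n}\log N_{\mathrm{DI}}(n,\lambda_1,\lambda_2)\;\le\;\frac12\,\overline{d}_M\!\left(\sqrt{\widetilde{\mathcal{X}}}\right). \]
   Context: $B$ is a finite-dimensional complex Hilbert space, $\mathcal{S}(B)$ the set of density matrices on $B$, $\mathcal{X}$ a measurable space. A cq-channel is a measurable map $W:\mathcal{X}\to\mathcal{S}(B)$, $x\mapsto W_x$; for $x^n\in\mathcal{X}^n$, $W_{x^n}=W_{x_1}\otimes\cdots\otimes W_{x_n}$. An $(n,N,\lambda_1,\lambda_2)$-deterministic identification (DI) code is a family $\{(u_j,E_j):j\in[N]\}$ with $u_j\in\mathcal{X}^n$ and operators $0\le E_j\le\mathbb{1}$ on $B^{\otimes n}$ with $\mathrm{Tr}\,W_{u_j}E_j\ge1-\lambda_1$ for all $j$ and $\mathrm{Tr}\,W_{u_j}E_k\le\lambda_2$ for all $j\ne k$. It is simultaneous if there is a POVM $(D_m:m\in\mathcal{M})$ and subsets $\mathcal{M}_j\subset\mathcal{M}$ with $E_j=\sum_{m\in\mathcal{M}_j}D_m$.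 $N_{\mathrm{DI}}(n,\lambda_1,\lambda_2)$ and $N^{\mathrm{sim}}_{\mathrm{DI}}(n,\lambda_1,\lambda_2)$ are the largest $N$ for general and simultaneous DI codes. Logarithms base 2; $\dot{C}^{\mathrm{sim,opt}}_{\mathrm{DI}}(W)=\inf_{\lambda_1,\lambda_2>0}\limsup_{n\to\infty}\frac{1}{n\log n}\log N^{\mathrm{sim}}_{\mathrm{DI}}(n,\lambda_1,\lambda_2)$. A POVM $T$ is informationally complete if $\sigma\mapsto(\mathrm{Tr}\,\sigma T_y)_y$ is injective on $\mathcal{S}(B)$. $\sqrt{\widehat{\mathcal{X}}}=\{(\sqrt{\mathrm{Tr}\,W_xT_y})_{y\in\mathcal{Y}}:x\in\mathcal{X}\}\subset\mathbb{R}^{\mathcal{Y}}$ (Euclidean metric); $\sqrt{\widetilde{\mathcal{X}}}=\{\sqrt{W_x}:x\in\mathcal{X}\}$ with the Hilbert–Schmidt metric $\|M-M'\|_2=\sqrt{\mathrm{Tr}(M-M')^2}$. For nonempty bounded $F$ in a finite-dimensional normed real space, $\Gamma_\delta(F)$ is the minimum number of closed $\delta$-balls centered in $F$ covering $F$, and $\overline{d}_M(F)=\limsup_{\delta\to0}\frac{\log\Gamma_\delta(F)}{-\log\delta}$. *)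

theory Defs
  imports "HOL-Analysis.Analysis" "HOL-Library.Liminf_Limsup" "Jordan_Normal_Form.Matrix"
begin

definition mtrace :: "complex mat \<Rightarrow> complex" where
  "mtrace A = (\<Sum>i<dim_row A. A $$ (i, i))"

text \<open>Positive semidefinite operator on C^n (this forces Hermiticity over C).\<close>
definition psd :: "nat \<Rightarrow> complex mat \<Rightarrow> bool" where
  "psd n A \<longleftrightarrow> A \<in> carrier_mat n n \<and>
     (\<forall>v :: nat \<Rightarrow> complex. let q = (\<Sum>i<n. \<Sum>j<n. cnj (v i) * A $$ (i, j) * v j)
        in Im q = 0 \<and> Re q \<ge> 0)"

definition density :: "nat \<Rightarrow> complex mat \<Rightarrow> bool" where
  "density n \<rho> \<longleftrightarrow> psd n \<rho> \<and> mtrace \<rho> = 1"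

definition effect :: "nat \<Rightarrow> complex mat \<Rightarrow> bool" where
  "effect n E \<longleftrightarrow> psd n E \<and> psd n (1\<^sub>m n - E)"

definition msum :: "nat \<Rightarrow> ('i \<Rightarrow> complex mat) \<Rightarrow> 'i set \<Rightarrow> complex mat" where
  "msum n f S = mat n n (\<lambda>(i, j). \<Sum>m\<in>S. f m $$ (i, j))"

definition povm :: "nat \<Rightarrow> 'i set \<Rightarrow> ('i \<Rightarrow> complex mat) \<Rightarrow> bool" where
  "povm n S T \<longleftrightarrow> finite S \<and> (\<forall>m\<in>S. psd n (T m)) \<and> msum n T S = 1\<^sub>m n"

definition informationally_complete :: "nat \<Rightarrow> 'i set \<Rightarrow> ('i \<Rightarrow> complex mat) \<Rightarrow> bool" where
  "informationally_complete n S T \<longleftrightarrow> povm n S T \<and>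
     (\<forall>\<sigma> \<sigma>'. density n \<sigma> \<longrightarrow> density n \<sigma>' \<longrightarrow>
        (\<forall>y\<in>S. mtrace (\<sigma> * T y) = mtrace (\<sigma>' * T y)) \<longrightarrow> \<sigma> = \<sigma>')"

definition kron :: "complex mat \<Rightarrow> complex mat \<Rightarrow> complex mat" where
  "kron A B = mat (dim_row A * dim_row B) (dim_col A * dim_col B)
     (\<lambda>(i, j). A $$ (i div dim_row B, j div dim_col B) * B $$ (i mod dim_row B, j mod dim_col B))"

definition tensor_word :: "('x \<Rightarrow> complex mat) \<Rightarrow> 'x list \<Rightarrow> complex mat" where
  "tensor_word W xs = foldr (\<lambda>x A. kron (W x) A) xs (1\<^sub>m 1)"

definition cq_channel :: "nat \<Rightarrow> 'x measure \<Rightarrow> ('x \<Rightarrow> complex mat) \<Rightarrow> bool" where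
  "cq_channel d X W \<longleftrightarrow> (\<forall>x\<in>space X. density d (W x)) \<and>
     (\<forall>i<d. \<forall>j<d. (\<lambda>x. W x $$ (i, j)) \<in> borel_measurable X)"

definition DI_code :: "nat \<Rightarrow> 'x measure \<Rightarrow> ('x \<Rightarrow> complex mat) \<Rightarrow> nat \<Rightarrow> nat \<Rightarrow> real \<Rightarrow> real
    \<Rightarrow> (nat \<Rightarrow> 'x list) \<Rightarrow> (nat \<Rightarrow> complex mat) \<Rightarrow> bool" where
  "DI_code d X W n N l1 l2 u E \<longleftrightarrow>
     (\<forall>j<N. u j \<in> lists (space X) \<and> length (u j) = n \<and> effect (d ^ n) (E j)
        \<and> Re (mtrace (tensor_word W (u j) * E j)) \<ge> 1 - l1) \<and>
     (\<forall>j<N. \<forall>k<N. j \<noteq> k \<longrightarrow> Re (mtrace (tensor_word W (u j) * E k)) \<le> l2)"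

definition simultaneous :: "nat \<Rightarrow> nat \<Rightarrow> nat \<Rightarrow> (nat \<Rightarrow> complex mat) \<Rightarrow> bool" where
  "simultaneous d n N E \<longleftrightarrow> (\<exists>(Mo :: nat set) D Ms. povm (d ^ n) Mo D \<and>
     (\<forall>j<N. Ms j \<subseteq> Mo \<and> E j = msum (d ^ n) D (Ms j)))"

definition N_DI :: "nat \<Rightarrow> 'x measure \<Rightarrow> ('x \<Rightarrow> complex mat) \<Rightarrow> nat \<Rightarrow> real \<Rightarrow> real \<Rightarrow> ereal" where
  "N_DI d X W n l1 l2 = (SUP N \<in> {N. \<exists>u E. DI_code d X W n N l1 l2 u E}. ereal (real N))"

definition N_DI_sim :: "nat \<Rightarrow> 'x measure \<Rightarrow> ('x \<Rightarrow> complex mat) \<Rightarrow> nat \<Rightarrow> real \<Rightarrow> real \<Rightarrow> ereal" where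
  "N_DI_sim d X W n l1 l2 =
     (SUP N \<in> {N. \<exists>u E. DI_code d X W n N l1 l2 u E \<and> simultaneous d n N E}. ereal (real N))"

definition elog2 :: "ereal \<Rightarrow> ereal" where
  "elog2 x = (if x = \<infinity> then \<infinity> else if x \<le> 0 then -\<infinity> else ereal (log 2 (real_of_ereal x)))"

definition rate :: "nat \<Rightarrow> ereal \<Rightarrow> ereal" where
  "rate n N = elog2 N / ereal (real n * log 2 (real n))"

definition C_DI_sim_opt :: "nat \<Rightarrow> 'x measure \<Rightarrow> ('x \<Rightarrow> complex mat) \<Rightarrow> ereal" where
  "C_DI_sim_opt d X W = (INF l1 \<in> {0<..}. INF l2 \<in> {0<..}.
      limsup (\<lambda>n. rate n (N_DI_sim d X W n l1 l2)))"

definition covering_number :: "('a \<Rightarrow> 'a \<Rightarrow> real) \<Rightarrow> 'a set \<Rightarrow> real \<Rightarrow> nat" where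
  "covering_number dst F \<delta> = (LEAST k. \<exists>C. C \<subseteq> F \<and> finite C \<and> card C = k \<and>
      F \<subseteq> (\<Union>c\<in>C. {y. dst c y \<le> \<delta>}))"

definition upper_minkowski_dim :: "('a \<Rightarrow> 'a \<Rightarrow> real) \<Rightarrow> 'a set \<Rightarrow> ereal" where
  "upper_minkowski_dim dst F = Limsup (at_right 0)
      (\<lambda>\<delta>. ereal (log 2 (real (covering_number dst F \<delta>)) / (- log 2 \<delta>)))"

text \<open>Hilbert-Schmidt distance sqrt(Tr (M - M')^2) (real for Hermitian M, M').\<close>
definition hs_dist :: "complex mat \<Rightarrow> complex mat \<Rightarrow> real" where
  "hs_dist M M' = sqrt (Re (mtrace ((M - M') * (M - M'))))"

definition mat_sqrt :: "nat \<Rightarrow> complex mat \<Rightarrow> complex mat" where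
  "mat_sqrt n A = (THE S. psd n S \<and> S * S = A)"

definition sqrt_hat :: "'x measure \<Rightarrow> ('x \<Rightarrow> complex mat) \<Rightarrow> ('y::finite \<Rightarrow> complex mat) \<Rightarrow> (real ^ 'y) set" where
  "sqrt_hat X W T = (\<lambda>x. \<chi> y. sqrt (Re (mtrace (W x * T y)))) ` space X"

definition sqrt_tilde :: "nat \<Rightarrow> 'x measure \<Rightarrow> ('x \<Rightarrow> complex mat) \<Rightarrow> complex mat set" where
  "sqrt_tilde d X W = (\<lambda>x. mat_sqrt d (W x)) ` space X"

end

theory Submission
  imports Defs "HOL-Real_Asymp.Real_Asymp"
begin

text \<open>
  For the upper bound, \<open>Tr W\<^sub>u E\<close> is the value of the quadratic form of \<open>E\<close> at the vector \<open>\<surd>W\<^sub>u\<close>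
  of the Hilbert-Schmidt space, so the square roots of two codewords must stay a constant apart. As
  \<open>Tr \<surd>W\<^sub>u \<surd>W\<^sub>v\<close> is a product over the letters, this fails as soon as all letters are within
  \<open>O(n powr (-1/2))\<close>; rounding the letters to the centres of a cover at that scale is therefore injective
  on codewords, whence \<open>N \<le> \<Gamma> ^ n\<close>.

  For the lower bound, every output system is measured with \<open>T\<close>, and the code is built for the
  resulting classical channel. Its letters form a packing at scale \<open>O(n powr (-1/4))\<close>, its words
  have linear Hamming distance and, by pigeonhole, almost equal entropies. The decoder of a word is its
  set of entropy-typical outputs. Two words have fidelity \<open>exp (- K * sqrt n)\<close> with a large constant \<open>K\<close>,
  while on the intersection of two typical sets the output probabilities are known up to factors
  \<open>exp (O (sqrt n))\<close>, which bounds the error of the second kind.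
\<close>

section \<open>Positive semidefinite matrices\<close>

text \<open>The factors 1/4 and 1/2 are the two scales in disguise. A code with about
  \<open>G ^ n\<close> words, \<open>G\<close> the covering number at \<open>\<delta>\<close>, has
  rate about \<open>log G / log n\<close>, and \<open>log n\<close> is
  \<open>4 * (- log \<delta>)\<close> up to a constant if \<open>\<delta> ^ 4\<close> is of order
  \<open>1 / n\<close>, but \<open>2 * (- log \<delta>)\<close> if \<open>\<delta>\<^sup>2\<close>
  is. The converse only asks that \<open>n * \<delta>\<^sup>2\<close> be a small constant. In the
  lower bound, \<open>n * \<delta>\<^sup>2\<close> is the order of the exponent of the fidelity, and
  it has to beat the fluctuation of the log-likelihood, which a second moment bounds by a multiple
  of \<open>sqrt n\<close>; hence the condition \<open>K \<le> \<delta> ^ 4 * n\<close>. Losses in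
  \<open>log N\<close> that are linear in \<open>n\<close> vanish against \<open>n * log n\<close>;
  the loss from the Hamming distance is a fraction \<open>t\<close> of the rate, and
  \<open>t\<close> is arbitrary. The dimension is an upper limit, so covering numbers may be large
  at some scales only: the lower bound must choose \<open>n\<close> after \<open>\<delta>\<close>,
  while the converse may choose \<open>\<delta>\<close> after \<open>n\<close>. Since
  \<open>mat_sqrt\<close> is a definite description, existence and uniqueness of roots both have to
  be shown. Everything is done with quadratic forms and the binomial series; no spectral
  decomposition enters.\<close>

definition inner_vec :: "nat \<Rightarrow> (nat \<Rightarrow> complex) \<Rightarrow> (nat \<Rightarrow> complex) \<Rightarrow> complex" where
  "inner_vec n u v = (\<Sum>i<n. cnj (u i) * v i)"

text \<open>The value 0 beyond \<open>n\<close> makes composition an equation between functions, the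
  form in which \<open>apply_mat_mult\<close> has it.\<close>

definition apply_mat :: "nat \<Rightarrow> complex mat \<Rightarrow> (nat \<Rightarrow> complex) \<Rightarrow> nat \<Rightarrow> complex" where
  "apply_mat n A v = (\<lambda>i. if i < n then \<Sum>j<n. A $$ (i, j) * v j else 0)"

definition hermitian_mat :: "nat \<Rightarrow> complex mat \<Rightarrow> bool" where
  "hermitian_mat n A \<longleftrightarrow> A \<in> carrier_mat n n \<and> (\<forall>i<n. \<forall>j<n. A $$ (j, i) = cnj (A $$ (i, j)))"

lemma index_mult_mat_sum:
  assumes "A \<in> carrier_mat n n" "B \<in> carrier_mat n n" "i < n" "j < n"
  shows "(A * B) $$ (i, j) = (\<Sum>k<n. A $$ (i, k) * B $$ (k, j))"
  using assms by (simp add: scalar_prod_def atLeast0LessThan)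

lemma inner_vec_cong: "(\<And>i. i < n \<Longrightarrow> u i = u' i) \<Longrightarrow> (\<And>i. i < n \<Longrightarrow> v i = v' i) \<Longrightarrow> inner_vec n u v = inner_vec n u' v'"
  by (simp add: inner_vec_def)

lemma inner_vec_lin_right: "inner_vec n u (\<lambda>i. a * v i + b * w i) = a * inner_vec n u v + b * inner_vec n u w"
  by (simp add: inner_vec_def sum_distrib_left algebra_simps flip: sum.distrib)

lemma inner_vec_lin_left: "inner_vec n (\<lambda>i. a * v i + b * w i) u = cnj a * inner_vec n v u + cnj b * inner_vec n w u"
  by (simp add: inner_vec_def sum_distrib_left algebra_simps flip: sum.distrib)

lemma inner_vec_self: "inner_vec n v v = of_real (\<Sum>i<n. (cmod (v i))\<^sup>2)"
  by (simp add: inner_vec_def complex_norm_square mult.commute del: of_real_power)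

lemma inner_vec_self_nonneg: "0 \<le> inner_vec n v v"
  unfolding inner_vec_self by (simp add: less_eq_complex_def sum_nonneg)

lemma apply_mat_lin: "apply_mat n A (\<lambda>i. a * v i + b * w i) = (\<lambda>i. a * apply_mat n A v i + b * apply_mat n A w i)"
  by (auto simp: apply_mat_def fun_eq_iff sum_distrib_left algebra_simps simp flip: sum.distrib)

lemma inner_vec_apply_mat: "inner_vec n u (apply_mat n A v) = (\<Sum>i<n. \<Sum>j<n. cnj (u i) * A $$ (i, j) * v j)"
  by (simp add: inner_vec_def apply_mat_def sum_distrib_left algebra_simps)

text \<open>The order on complex numbers packs both conditions into one: \<open>0 \<le> z\<close>
  means that \<open>z\<close> is real and nonnegative.\<close>

lemma psd_iff: "psd n A \<longleftrightarrow> A \<in> carrier_mat n n \<and> (\<forall>v. 0 \<le> inner_vec n v (apply_mat n A v))"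
  unfolding psd_def inner_vec_apply_mat Let_def less_eq_complex_def by auto

lemma apply_mat_mult:
  assumes "A \<in> carrier_mat n n" "B \<in> carrier_mat n n"
  shows "apply_mat n (A * B) v = apply_mat n A (apply_mat n B v)"
proof
  fix i
  show "apply_mat n (A * B) v i = apply_mat n A (apply_mat n B v) i"
  proof (cases "i < n")
    case True
    have "apply_mat n (A * B) v i = (\<Sum>j<n. \<Sum>k<n. A $$ (i, k) * B $$ (k, j) * v j)"
      using True by (simp add: apply_mat_def index_mult_mat_sum[OF assms] sum_distrib_right del: index_mult_mat)
    also have "\<dots> = (\<Sum>k<n. \<Sum>j<n. A $$ (i, k) * B $$ (k, j) * v j)"
      by (rule sum.swap)
    also have "\<dots> = apply_mat n A (apply_mat n B v) i"
      using True by (simp add: apply_mat_def sum_distrib_left mult.assoc)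
    finally show ?thesis .
  qed (simp add: apply_mat_def)
qed

lemma apply_mat_one: "apply_mat n (1\<^sub>m n) v = (\<lambda>i. if i < n then v i else 0)"
proof
  fix i
  show "apply_mat n (1\<^sub>m n) v i = (if i < n then v i else 0)"
  proof (cases "i < n")
    case True
    then have "apply_mat n (1\<^sub>m n) v i = (\<Sum>j<n. if j = i then v j else 0)"
      unfolding apply_mat_def by (simp only: if_True) (intro sum.cong refl, simp)
    then show ?thesis using True by simp
  qed (simp add: apply_mat_def)
qed

lemma inner_vec_apply_mat_one: "inner_vec n u (apply_mat n (1\<^sub>m n) v) = inner_vec n u v"
  by (rule inner_vec_cong) (simp_all add: apply_mat_one)

lemma inner_vec_apply_mat_minus:
  assumes "A \<in> carrier_mat n n" "B \<in> carrier_mat n n"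
  shows "inner_vec n u (apply_mat n (A - B) v) = inner_vec n u (apply_mat n A v) - inner_vec n u (apply_mat n B v)"
  using assms by (simp add: inner_vec_apply_mat algebra_simps flip: sum_subtractf)

lemma inner_vec_apply_mat_units:
  assumes "i < n" "j < n"
  shows "inner_vec n (\<lambda>k. of_bool (k = i)) (apply_mat n A (\<lambda>k. of_bool (k = j))) = A $$ (i, j)"
proof -
  have "inner_vec n (\<lambda>k. of_bool (k = i)) (apply_mat n A (\<lambda>k. of_bool (k = j)))
      = (\<Sum>i'<n. \<Sum>j'<n. of_bool (i' = i) * (of_bool (j' = j) * A $$ (i', j')))"
    unfolding inner_vec_apply_mat by (intro sum.cong refl) auto
  also have "\<dots> = A $$ (i, j)"
    using assms by (simp flip: sum_distrib_left)
  finally show ?thesis .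
qed

text \<open>Different choices of \<open>a\<close> and \<open>b\<close> yield Hermitian symmetry, the
  Cauchy-Schwarz inequality and a weighted triangle inequality.\<close>

lemma psd_form_expand:
  assumes "psd n A"
  shows "0 \<le> cnj a * a * inner_vec n u (apply_mat n A u) + cnj a * b * inner_vec n u (apply_mat n A v)
     + cnj b * a * inner_vec n v (apply_mat n A u) + cnj b * b * inner_vec n v (apply_mat n A v)"
proof -
  have "0 \<le> inner_vec n (\<lambda>i. a * u i + b * v i) (apply_mat n A (\<lambda>i. a * u i + b * v i))"
    using assms psd_iff by blast
  then show ?thesis
    by (simp add: apply_mat_lin inner_vec_lin_left inner_vec_lin_right algebra_simps)
qed

text \<open>Polarisation: \<open>a = b = 1\<close> makes the sum of the two cross terms real, and
  \<open>b = \<i>\<close> makes their difference imaginary.\<close>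

lemma psd_form_commute:
  assumes "psd n A"
  shows "inner_vec n v (apply_mat n A u) = cnj (inner_vec n u (apply_mat n A v))"
proof -
  have u: "0 \<le> inner_vec n u (apply_mat n A u)" and v: "0 \<le> inner_vec n v (apply_mat n A v)"
    using assms psd_iff by blast+
  show ?thesis
    using psd_form_expand[OF assms, of 1 u 1 v] psd_form_expand[OF assms, of 1 u \<i> v] u v
    by (simp add: less_eq_complex_def complex_eq_iff)
qed

lemma psd_hermitian_mat: "psd n A \<Longrightarrow> hermitian_mat n A"
  using psd_form_commute[of n A] inner_vec_apply_mat_units[of _ n _ A] psd_iff[of n A]
  unfolding hermitian_mat_def by metis

lemma hermitian_mat_adjoint:
  assumes "hermitian_mat n A"
  shows "inner_vec n u (apply_mat n A v) = inner_vec n (apply_mat n A u) v"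
proof -
  have "inner_vec n u (apply_mat n A v) = (\<Sum>j<n. \<Sum>i<n. cnj (u i) * A $$ (i, j) * v j)"
    unfolding inner_vec_apply_mat by (rule sum.swap)
  also have "\<dots> = (\<Sum>j<n. \<Sum>i<n. cnj (u i) * cnj (A $$ (j, i)) * v j)"
    using assms by (intro sum.cong refl) (metis hermitian_mat_def lessThan_iff)
  also have "\<dots> = inner_vec n (apply_mat n A u) v"
    by (simp add: inner_vec_def apply_mat_def sum_distrib_left sum_distrib_right mult.commute mult.left_commute)
  finally show ?thesis .
qed

text \<open>The form may be degenerate, so the usual division by \<open>b\<close> is replaced by the
  choice \<open>r = b\<close>, \<open>s = 1\<close>, which gives
  \<open>0 \<le> b * (a * b - (cmod c)\<^sup>2)\<close>; the case \<open>b = 0\<close> is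
  separate.\<close>

lemma psd_cauchy_schwarz:
  assumes "psd n A"
  shows "(cmod (inner_vec n u (apply_mat n A v)))\<^sup>2 \<le> Re (inner_vec n u (apply_mat n A u)) * Re (inner_vec n v (apply_mat n A v))"
proof -
  define a b c where "a = Re (inner_vec n u (apply_mat n A u))" and "b = Re (inner_vec n v (apply_mat n A v))"
    and "c = inner_vec n u (apply_mat n A v)"
  have u: "inner_vec n u (apply_mat n A u) = of_real a" and v: "inner_vec n v (apply_mat n A v) = of_real b"
    and ab: "0 \<le> a" "0 \<le> b"
    using assms unfolding psd_iff a_def b_def less_eq_complex_def by (simp_all add: complex_eq_iff)
  have vu: "inner_vec n v (apply_mat n A u) = cnj c"
    unfolding c_def by (rule psd_form_commute[OF assms])
  \<comment> \<open>The factor \<open>cnj c\<close> on \<open>v\<close> turns both cross terms into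
    multiples of \<open>(cmod c)\<^sup>2\<close>, so the phase of \<open>c\<close>
    disappears.\<close>
  have *: "0 \<le> r\<^sup>2 * a - 2 * r * s * (cmod c)\<^sup>2 + s\<^sup>2 * (cmod c)\<^sup>2 * b" for r s :: real
  proof -
    have "0 \<le> Re (of_real r * of_real r * of_real a + of_real r * (- of_real s * cnj c) * c
       + - of_real s * c * of_real r * cnj c + - of_real s * c * (- of_real s * cnj c) * of_real b)"
      using psd_form_expand[OF assms, of "of_real r" u "- of_real s * cnj c" v]
      unfolding u v vu c_def[symmetric] by (simp add: less_eq_complex_def)
    also have "\<dots> = r\<^sup>2 * a - 2 * r * s * (cmod c)\<^sup>2 + s\<^sup>2 * (cmod c)\<^sup>2 * b"
      unfolding cmod_power2 by (simp add: power2_eq_square algebra_simps)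
    finally show ?thesis .
  qed
  have "(cmod c)\<^sup>2 \<le> a * b"
  proof (cases "b = 0")
    case True
    show ?thesis
    proof (rule ccontr)
      assume "\<not> ?thesis"
      with True have c: "(cmod c)\<^sup>2 > 0" by simp
      \<comment> \<open>For \<open>b = 0\<close> the bound is affine in \<open>s\<close>; this
        \<open>s\<close> brings it down to -1.\<close>
      have "0 \<le> a - 2 * ((a + 1) / (2 * (cmod c)\<^sup>2)) * (cmod c)\<^sup>2"
        using *[of 1 "(a + 1) / (2 * (cmod c)\<^sup>2)"] True by simp
      with c show False by (simp add: field_simps)
    qed
  next
    case False
    have "0 \<le> b * (a * b - (cmod c)\<^sup>2)"
      using *[of b 1] by (simp add: power2_eq_square algebra_simps)
    with False ab show ?thesis
      by (simp add: zero_le_mult_iff)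
  qed
  then show ?thesis unfolding a_def b_def c_def .
qed

lemma psd_carrier: "psd n A \<Longrightarrow> A \<in> carrier_mat n n"
  by (simp add: psd_def)

lemma hermitian_mat_carrier: "hermitian_mat n A \<Longrightarrow> A \<in> carrier_mat n n"
  by (simp add: hermitian_mat_def)

lemma psd_one: "psd n (1\<^sub>m n)"
  by (simp add: psd_iff inner_vec_apply_mat_one inner_vec_self_nonneg)

lemma psd_entry_cauchy_schwarz:
  assumes "psd n A" "i < n" "j < n"
  shows "(cmod (A $$ (i, j)))\<^sup>2 \<le> Re (A $$ (i, i)) * Re (A $$ (j, j))"
  using psd_cauchy_schwarz[OF assms(1), of "\<lambda>k. of_bool (k = i)" "\<lambda>k. of_bool (k = j)"]
  using assms by (simp add: inner_vec_apply_mat_units)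

lemma psd_diag_nonneg: "psd n A \<Longrightarrow> i < n \<Longrightarrow> 0 \<le> A $$ (i, i)"
  using inner_vec_apply_mat_units[of i n i A] unfolding psd_iff by metis

lemma psd_sandwich:
  assumes "psd n A" "hermitian_mat n H"
  shows "psd n (H * A * H)"
proof -
  have "inner_vec n v (apply_mat n (H * A * H) v) = inner_vec n (apply_mat n H v) (apply_mat n A (apply_mat n H v))" for v
    using psd_carrier[OF assms(1)] hermitian_mat_carrier[OF assms(2)]
    by (simp add: apply_mat_mult hermitian_mat_adjoint[OF assms(2)])
  with assms psd_carrier[OF assms(1)] hermitian_mat_carrier[OF assms(2)] show ?thesis by (auto simp: psd_iff)
qed

lemma hermitian_mat_square_psd: "hermitian_mat n H \<Longrightarrow> psd n (H * H)"
  using psd_sandwich[OF psd_one, of n H] right_mult_one_mat[of H n n] by (simp add: hermitian_mat_carrier)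

lemma psd_trace_zero:
  assumes "psd n A" "mtrace A = 0"
  shows "A = 0\<^sub>m n n"
proof -
  have A: "A \<in> carrier_mat n n" using assms psd_carrier by blast
  have "\<forall>i\<in>{..<n}. A $$ (i, i) = 0"
    using assms(2) A psd_diag_nonneg[OF assms(1)] sum_nonneg_eq_0_iff[of "{..<n}" "\<lambda>i. A $$ (i, i)"]
    by (auto simp: mtrace_def)
  then have "A $$ (i, j) = 0" if "i < n" "j < n" for i j
    using psd_entry_cauchy_schwarz[OF assms(1) that] that by simp
  with A show ?thesis by auto
qed

text \<open>The diagonal entries of \<open>H * H\<close> are the squared norms of the columns of
  \<open>H\<close>.\<close>

lemma hermitian_mat_square_zero:
  assumes "hermitian_mat n H" "H * H = 0\<^sub>m n n"
  shows "H = 0\<^sub>m n n"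
proof -
  have H: "H \<in> carrier_mat n n" using assms hermitian_mat_carrier by blast
  have "H $$ (i, j) = 0" if "i < n" "j < n" for i j
  proof -
    have "(\<Sum>k<n. complex_of_real ((cmod (H $$ (k, j)))\<^sup>2)) = (H * H) $$ (j, j)"
      unfolding index_mult_mat_sum[OF H H that(2) that(2)] using assms(1) that
      by (intro sum.cong refl) (metis complex_norm_square hermitian_mat_def lessThan_iff mult.commute)
    also have "\<dots> = 0" using assms(2) that by simp
    finally have "(\<Sum>k<n. (cmod (H $$ (k, j)))\<^sup>2) = 0"
      by (metis of_real_eq_0_iff of_real_sum)
    then show ?thesis using that by (simp add: sum_nonneg_eq_0_iff)
  qed
  with H show ?thesis by auto
qed

lemma mtrace_comm:
  assumes "A \<in> carrier_mat n n" "B \<in> carrier_mat n n"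
  shows "mtrace (A * B) = mtrace (B * A)"
proof -
  have "mtrace (A * B) = (\<Sum>i<n. \<Sum>k<n. A $$ (i, k) * B $$ (k, i))"
    using assms by (simp add: mtrace_def index_mult_mat_sum[OF assms] del: index_mult_mat(1))
  also have "\<dots> = (\<Sum>k<n. \<Sum>i<n. A $$ (i, k) * B $$ (k, i))" by (rule sum.swap)
  also have "\<dots> = mtrace (B * A)"
    using assms by (simp add: mtrace_def index_mult_mat_sum[OF assms(2,1)] mult.commute del: index_mult_mat(1))
  finally show ?thesis .
qed

lemma mtrace_nonneg: "psd n A \<Longrightarrow> 0 \<le> mtrace A"
  using psd_carrier[of n A] by (auto simp: mtrace_def intro!: sum_nonneg psd_diag_nonneg)

lemma mtrace_add: 
  assumes "A \<in> carrier_mat n n" "B \<in> carrier_mat n n"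
  shows "mtrace (A + B) = mtrace A + mtrace B"
  using assms by (simp add: mtrace_def sum.distrib)

text \<open>With \<open>D = S - R\<close> one has \<open>S D + D R = 0\<close>; multiplying by \<open>D\<close> and taking traces
  forces the positive matrices \<open>D S D\<close> and \<open>D R D\<close> to vanish, hence \<open>D\<^sup>3 = 0\<close>.\<close>

lemma psd_sqrt_unique:
  assumes S: "psd n S" and R: "psd n R" and eq: "S * S = R * R"
  shows "S = R"
proof -
  have c: "S \<in> carrier_mat n n" "R \<in> carrier_mat n n" using S R psd_carrier by auto
  define D where "D = S - R"
  have cD: "D \<in> carrier_mat n n" unfolding D_def by (rule minus_carrier_mat) (rule c)
  note cc = c cD mult_carrier_mat[OF c(1) cD] mult_carrier_mat[OF cD c(1)] mult_carrier_mat[OF cD c(2)]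
    mult_carrier_mat[OF cD cD]
  have dims[simp]: "dim_row S = n" "dim_col S = n" "dim_row R = n" "dim_col R = n"
    using S R psd_carrier by blast+
  have hD: "hermitian_mat n D"
    unfolding hermitian_mat_def
  proof (intro conjI allI impI cD)
    fix i j assume "i < n" "j < n"
    then have "S $$ (j, i) = cnj (S $$ (i, j))" "R $$ (j, i) = cnj (R $$ (i, j))"
      using psd_hermitian_mat[OF S] psd_hermitian_mat[OF R] unfolding hermitian_mat_def by blast+
    with \<open>i < n\<close> \<open>j < n\<close> show "D $$ (j, i) = cnj (D $$ (i, j))"
      by (simp add: D_def)
  qed
  have 1: "S * D + D * R = 0\<^sub>m n n"
  proof -
    have "S * D + D * R = (S * S - S * R) + (S * R - R * R)"
      unfolding D_def mult_minus_distrib_mat[OF c(1) c(1) c(2)] minus_mult_distrib_mat[OF c(1) c(2) c(2)] ..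
    also have "\<dots> = 0\<^sub>m n n" unfolding eq by (intro eq_matI) auto
    finally show ?thesis .
  qed
  have "mtrace (D * S * D) + mtrace (D * R * D) = 0"
  proof -
    have "mtrace (D * R * D) = mtrace (D * (D * R))"
      by (rule mtrace_comm[OF cc(6) cD])
    moreover have "D * S * D = D * (S * D)" by (rule assoc_mult_mat[OF cD c(1) cD])
    moreover have "mtrace (D * (S * D)) + mtrace (D * (D * R)) = mtrace (D * (S * D + D * R))"
      unfolding mult_add_distrib_mat[OF cD cc(4) cc(6)]
      by (rule mtrace_add[symmetric]) (rule mult_carrier_mat[OF cD] cc)+
    moreover have "mtrace (D * 0\<^sub>m n n) = 0"
      using cD by (simp add: mtrace_def)
    ultimately show ?thesis using 1 by simp
  qed
  moreover have p: "psd n (D * S * D)" "psd n (D * R * D)"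
    using S R hD psd_sandwich by blast+
  ultimately have "mtrace (D * S * D) = 0" "mtrace (D * R * D) = 0"
    using mtrace_nonneg[OF p(1)] mtrace_nonneg[OF p(2)] by (simp_all add: add_nonneg_eq_0_iff)
  then have z: "D * S * D = 0\<^sub>m n n" "D * R * D = 0\<^sub>m n n"
    using p psd_trace_zero by blast+
  have "D * D * D = D * S * D - D * R * D"
  proof -
    have "D * D = D * S - D * R"
      using mult_minus_distrib_mat[OF cD c] unfolding D_def .
    then have "D * D * D = (D * S - D * R) * D" by (rule arg_cong)
    also have "\<dots> = D * S * D - D * R * D"
      by (rule minus_mult_distrib_mat[OF cc(5,6) cD])
    finally show ?thesis .
  qed
  with z have "D * D * D = 0\<^sub>m n n" by simp
  \<comment> \<open>The fourth power is a square of a Hermitian square, so the lemma on vanishing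
    squares applies twice.\<close>
  then have "(D * D) * (D * D) = 0\<^sub>m n n"
    using assoc_mult_mat[OF cc(7) cD cD] left_mult_zero_mat[OF cD] by simp
  then have "D * D = 0\<^sub>m n n"
    using hermitian_mat_square_zero hermitian_mat_square_psd[OF hD] psd_hermitian_mat by blast
  then have "D = 0\<^sub>m n n" using hermitian_mat_square_zero hD by blast
  then have "(S - R) $$ (i, j) = 0" if "i < n" "j < n" for i j
    using that by (simp add: D_def)
  then show ?thesis by (intro eq_matI) auto
qed

section \<open>Square roots\<close>

lemma pow_mat_add:
  fixes A :: "complex mat"
  assumes A: "A \<in> carrier_mat n n"
  shows "A ^\<^sub>m (i + j) = A ^\<^sub>m i * A ^\<^sub>m j"
proof (induction j)
  case 0
  show ?case using A by simp
next
  case (Suc j)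
  then show ?case
    using assoc_mult_mat[OF pow_carrier_mat[OF A] pow_carrier_mat[OF A] A, of i j] by simp
qed

lemma effect_iff:
  "effect n B \<longleftrightarrow> psd n B \<and> (\<forall>v. inner_vec n v (apply_mat n B v) \<le> inner_vec n v v)"
proof (cases "psd n B")
  case True
  then have c: "B \<in> carrier_mat n n" by (rule psd_carrier)
  show ?thesis
    using True minus_carrier_mat[OF c, of "1\<^sub>m n"] unfolding effect_def psd_iff
    by (simp add: inner_vec_apply_mat_minus[OF one_carrier_mat c] inner_vec_apply_mat_one)
qed (simp add: effect_def)

text \<open>Induction in steps of two: since \<open>B\<close> is self-adjoint, the form of
  \<open>B ^\<^sub>m (m + 2)\<close> at \<open>v\<close> is the form of \<open>B ^\<^sub>m m\<close>
  at \<open>B v\<close>, and no product of different positive matrices has to be shown positive. The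
  vector \<open>w = B v\<close> is no longer than \<open>v\<close>, because Cauchy-Schwarz for the
  form of \<open>B\<close> gives \<open>x\<^sup>2 \<le> y * x\<close> for the squared lengths
  \<open>x\<close> of \<open>w\<close> and \<open>y\<close> of \<open>v\<close>.\<close>

lemma effect_pow:
  assumes B: "effect n B"
  shows "effect n (B ^\<^sub>m k)"
proof (induction k rule: less_induct)
  case (less k)
  have psdB: "psd n B" using B by (simp add: effect_def)
  then have c: "B \<in> carrier_mat n n" by (rule psd_carrier)
  consider "k = 0" | "k = 1" | m where "k = Suc (Suc m)"
    by (metis One_nat_def not0_implies_Suc)
  then show ?case
  proof cases
    case 1
    then show ?thesis using c psd_one by (simp add: effect_iff inner_vec_apply_mat_one)
  next
    case 2
    then show ?thesis using B c by simp
  next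
    case (3 m)
    have cm: "B ^\<^sub>m m \<in> carrier_mat n n" using c by (rule pow_carrier_mat)
    have e: "effect n (B ^\<^sub>m m)" using less 3 by simp
    have k: "k = 1 + (m + 1)" using 3 by simp
    have eq: "B ^\<^sub>m k = B * (B ^\<^sub>m m * B)"
      unfolding k pow_mat_add[OF c] using c by simp
    then have eq': "B ^\<^sub>m k = B * B ^\<^sub>m m * B"
      using assoc_mult_mat[OF c cm c] by simp
    have form: "inner_vec n v (apply_mat n (B ^\<^sub>m k) v) = inner_vec n (apply_mat n B v) (apply_mat n (B ^\<^sub>m m) (apply_mat n B v))" for v
      unfolding eq apply_mat_mult[OF c mult_carrier_mat[OF cm c]] apply_mat_mult[OF cm c]
      by (rule hermitian_mat_adjoint[OF psd_hermitian_mat[OF psdB]])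
    have contr: "inner_vec n (apply_mat n B v) (apply_mat n B v) \<le> inner_vec n v v" for v
    proof -
      define w where "w = apply_mat n B v"
      define x y where "x = Re (inner_vec n w w)" and "y = Re (inner_vec n v v)"
      have xy: "inner_vec n w w = of_real x" "inner_vec n v v = of_real y" "0 \<le> x" "0 \<le> y"
        unfolding x_def y_def inner_vec_self by (simp_all add: sum_nonneg)
      have "x\<^sup>2 = (cmod (inner_vec n v (apply_mat n B w)))\<^sup>2"
        using xy(1) hermitian_mat_adjoint[OF psd_hermitian_mat[OF psdB], of v w] by (simp add: w_def)
      also have "\<dots> \<le> Re (inner_vec n v (apply_mat n B v)) * Re (inner_vec n w (apply_mat n B w))"
        by (rule psd_cauchy_schwarz[OF psdB])
      also have "\<dots> \<le> y * x"
      proof (rule mult_mono)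
        show "Re (inner_vec n v (apply_mat n B v)) \<le> y" "Re (inner_vec n w (apply_mat n B w)) \<le> x"
          using B unfolding effect_iff x_def y_def less_eq_complex_def by auto
        show "0 \<le> Re (inner_vec n w (apply_mat n B w))"
          using psdB unfolding psd_iff less_eq_complex_def by auto
      qed (use xy in auto)
      finally have "x \<le> y" using xy by (cases "x = 0") (auto simp: power2_eq_square)
      then show ?thesis using xy unfolding w_def by (simp add: less_eq_complex_def)
    qed
    show ?thesis
      unfolding effect_iff
    proof (intro conjI allI)
      show "psd n (B ^\<^sub>m k)"
        unfolding eq' using e psdB by (intro psd_sandwich psd_hermitian_mat) (auto simp: effect_def)
      fix v
      show "inner_vec n v (apply_mat n (B ^\<^sub>m k) v) \<le> inner_vec n v v"
        unfolding form using e contr[of v] unfolding effect_iff by (meson order_trans)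
    qed
  qed
qed

lemma effect_entry_le:
  assumes "effect n B" "i < n" "j < n"
  shows "cmod (B $$ (i, j)) \<le> 1"
proof -
  have d: "0 \<le> Re (B $$ (k, k)) \<and> Re (B $$ (k, k)) \<le> 1" if "k < n" for k
  proof -
    have "0 \<le> B $$ (k, k)" using assms psd_diag_nonneg that by (auto simp: effect_def)
    moreover have "0 \<le> (1\<^sub>m n - B) $$ (k, k)"
      using assms psd_diag_nonneg that by (auto simp: effect_def)
    moreover have "B \<in> carrier_mat n n" using assms psd_carrier by (auto simp: effect_def)
    ultimately show ?thesis using that by (auto simp: less_eq_complex_def)
  qed
  have "(cmod (B $$ (i, j)))\<^sup>2 \<le> Re (B $$ (i, i)) * Re (B $$ (j, j))"
    using assms psd_entry_cauchy_schwarz by (auto simp: effect_def)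
  also have "\<dots> \<le> 1 * 1" using d assms by (intro mult_mono) auto
  finally show ?thesis using power2_le_imp_le[of _ 1] by simp
qed

section \<open>The Taylor coefficients of \<open>sqrt (1 - x)\<close> at 0\<close>

definition sqrt_coeff :: "nat \<Rightarrow> real" where
  "sqrt_coeff k = (- 1) ^ k * ((1/2) gchoose k)"

lemma sqrt_coeff_Suc: "sqrt_coeff (Suc k) = sqrt_coeff k * (real k - 1/2) / (real k + 1)"
proof -
  have "of_nat (Suc k) * ((1/2 :: real) gchoose Suc k) = (1/2 - of_nat k) * ((1/2) gchoose k)"
    using gbinomial_mult_1[of "1/2 :: real" k] by (simp add: algebra_simps)
  then have "((1/2 :: real) gchoose Suc k) = (1/2 - of_nat k) * ((1/2) gchoose k) / (real k + 1)"
    by (metis add.commute of_nat_Suc nonzero_mult_div_cancel_left of_nat_neq_0)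
  note * = this
  show ?thesis unfolding sqrt_coeff_def * by (simp add: field_simps)
qed

lemma sqrt_coeff_0: "sqrt_coeff 0 = 1"
  by (simp add: sqrt_coeff_def)

lemma sqrt_coeff_nonpos: "sqrt_coeff (Suc k) \<le> 0"
proof (induction k)
  case 0
  show ?case by (simp add: sqrt_coeff_Suc sqrt_coeff_0)
next
  case (Suc k)
  then have "sqrt_coeff (Suc k) * (real (Suc k) - 1/2) \<le> 0"
    by (intro mult_nonpos_nonneg) auto
  then show ?case unfolding sqrt_coeff_Suc[of "Suc k"] by (intro divide_nonpos_pos) auto
qed

text \<open>With this closed form, the sign of a single coefficient decides the sign of a partial
  sum, and the series need not be evaluated at its boundary point.\<close>

lemma sqrt_coeff_sum: "(\<Sum>k<Suc m. sqrt_coeff k) = - (2 * real m + 2) * sqrt_coeff (Suc m)"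
proof (induction m)
  case 0
  show ?case by (simp add: sqrt_coeff_Suc sqrt_coeff_0)
next
  case (Suc m)
  have "(\<Sum>k<Suc (Suc m). sqrt_coeff k) = - (2 * real m + 1) * sqrt_coeff (Suc m)"
    unfolding sum.lessThan_Suc[of _ "Suc m"] Suc by (simp add: algebra_simps)
  also have "\<dots> = - (2 * real (Suc m) + 2) * sqrt_coeff (Suc (Suc m))"
    unfolding sqrt_coeff_Suc[of "Suc m"] by (simp add: field_simps)
  finally show ?case .
qed

lemma sqrt_coeff_sum_nonneg: "0 \<le> (\<Sum>k<m. sqrt_coeff k)"
proof (cases m)
  case (Suc l)
  show ?thesis unfolding Suc sqrt_coeff_sum
    by (intro mult_nonpos_nonpos sqrt_coeff_nonpos) simp
qed simp

lemma summable_abs_sqrt_coeff: "summable (\<lambda>k. \<bar>sqrt_coeff k\<bar>)"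
proof (rule summableI_nonneg_bounded)
  fix m
  \<comment> \<open>Only the coefficient at 0 is positive, and it equals 1, so its absolute value is
    2 minus itself; all others merely change sign.\<close>
  have "(\<Sum>k<m. \<bar>sqrt_coeff k\<bar>) = (\<Sum>k<m. (if k = 0 then 2 else 0) - sqrt_coeff k)"
  proof (intro sum.cong refl)
    fix k
    show "\<bar>sqrt_coeff k\<bar> = (if k = 0 then 2 else 0) - sqrt_coeff k"
      using sqrt_coeff_nonpos[of "k - 1"] by (cases k) (auto simp: sqrt_coeff_0)
  qed
  also have "\<dots> \<le> 2"
    using sqrt_coeff_sum_nonneg[of m] by (simp add: sum_subtractf)
  finally show "(\<Sum>k<m. \<bar>sqrt_coeff k\<bar>) \<le> 2" .
qed simp

text \<open>The coefficient form of \<open>sqrt (1 - x) * sqrt (1 - x) = 1 - x\<close>: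
  Vandermonde's identity adds the two exponents 1/2.\<close>

lemma sqrt_coeff_convolution:
  "(\<Sum>i\<le>m. sqrt_coeff i * sqrt_coeff (m - i)) = (if m = 0 then 1 else if m = 1 then -1 else 0)"
proof -
  have "(\<Sum>i\<le>m. sqrt_coeff i * sqrt_coeff (m - i)) = (\<Sum>i\<in>{0..m}. (-1)^m * (((1/2) gchoose i) * ((1/2) gchoose (m - i))))"
    unfolding atLeast0AtMost sqrt_coeff_def
    by (intro sum.cong refl) (auto simp: mult_ac simp flip: power_add)
  also have "\<dots> = (-1)^m * ((1 :: real) gchoose m)"
    by (simp add: gbinomial_Vandermonde flip: sum_distrib_left)
  also have "((1 :: real) gchoose m) = of_nat (1 choose m)"
    by (metis binomial_gbinomial of_nat_1)
  also have "(-1)^m * real (1 choose m) = (if m = 0 then 1 else if m = 1 then -1 else 0)"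
    by (cases m) (auto simp: binomial_eq_0)
  finally show ?thesis .
qed

text \<open>All coefficients after the first are nonpositive, so replacing every weight by the
  largest one, \<open>t 0\<close>, lowers the sum, and what remains is a multiple of a partial sum
  of coefficients. The weights will be the forms of the powers of an effect at a fixed
  vector.\<close>

lemma sqrt_coeff_weighted_nonneg:
  assumes t: "\<And>k. 0 \<le> t k" "\<And>k. t k \<le> t 0" and s: "(\<lambda>k. sqrt_coeff k * t k) sums s"
  shows "0 \<le> s"
proof (rule LIMSEQ_le_const[OF s[unfolded sums_def]], intro exI allI impI)
  fix m
  have "0 \<le> t 0 * (\<Sum>k<m. sqrt_coeff k)" using t(1) sqrt_coeff_sum_nonneg by simp
  also have "\<dots> = (\<Sum>k<m. sqrt_coeff k * t 0)" by (simp add: sum_distrib_left mult.commute)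
  also have "\<dots> \<le> (\<Sum>k<m. sqrt_coeff k * t k)"
  proof (rule sum_mono)
    fix k
    show "sqrt_coeff k * t 0 \<le> sqrt_coeff k * t k"
      using sqrt_coeff_nonpos[of "k - 1"] t(2)[of k] by (cases k) (auto intro: mult_left_mono_neg)
  qed
  finally show "0 \<le> (\<Sum>k<m. sqrt_coeff k * t k)" .
qed

text \<open>The square root is the binomial series \<open>\<surd>(1 - (1 - C)) = \<Sum>k. (1/2 gchoose k) (-1)\<^sup>k (1 - C)\<^sup>k\<close>,
  which converges entrywise because its coefficients are absolutely summable.\<close>

lemma effect_sqrt_exists:
  assumes C: "effect n C"
  shows "\<exists>S. psd n S \<and> S * S = C"
proof -
  have cC: "C \<in> carrier_mat n n" using C psd_carrier by (auto simp: effect_def)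
  define B where "B = 1\<^sub>m n - C"
  have cB: "B \<in> carrier_mat n n" unfolding B_def using cC by (rule minus_carrier_mat)
  have "1\<^sub>m n - B = C" unfolding B_def using cC by auto
  then have B: "effect n B" using C unfolding effect_def B_def by auto
  define b where "b k i j = of_real (sqrt_coeff k) * (B ^\<^sub>m k) $$ (i, j)" for k i j
  have summ: "summable (\<lambda>k. norm (b k i j))" if "i < n" "j < n" for i j
  proof (rule summable_comparison_test'[OF summable_abs_sqrt_coeff])
    fix k
    have "\<bar>sqrt_coeff k\<bar> * cmod ((B ^\<^sub>m k) $$ (i, j)) \<le> \<bar>sqrt_coeff k\<bar> * 1"
      using effect_entry_le[OF effect_pow[OF B] that] by (intro mult_left_mono) auto
    then show "norm (norm (b k i j)) \<le> \<bar>sqrt_coeff k\<bar>" by (simp add: b_def norm_mult)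
  qed
  have summ': "summable (\<lambda>k. b k i j)" if "i < n" "j < n" for i j
    using summable_norm_cancel[OF summ[OF that]] .
  define S where "S = mat n n (\<lambda>(i, j). \<Sum>k. b k i j)"
  have cS: "S \<in> carrier_mat n n" by (simp add: S_def)
  have "S * S = C"
  proof (rule eq_matI)
    fix i j assume "i < dim_row C" "j < dim_col C"
    then have ij: "i < n" "j < n" using cC by auto
    have "(\<lambda>m. \<Sum>l<n. \<Sum>k\<le>m. b k i l * b (m - k) l j) sums (\<Sum>l<n. (\<Sum>k. b k i l) * (\<Sum>k. b k l j))"
      using ij by (intro sums_sum Cauchy_product_sums summ) auto
    \<comment> \<open>The term of degree \<open>m\<close> in the Cauchy product is the convolution
      of the coefficients times \<open>B ^\<^sub>m m\<close>, so only degrees 0 and 1 survive, with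
      sum \<open>1 - B = C\<close>.\<close>
    also have "(\<lambda>m. \<Sum>l<n. \<Sum>k\<le>m. b k i l * b (m - k) l j)
       = (\<lambda>m. if m \<in> {0,1} then (if m = 0 then 1\<^sub>m n $$ (i, j) else - B $$ (i, j)) else 0)"
    proof
      fix m
      have "(\<Sum>l<n. \<Sum>k\<le>m. b k i l * b (m - k) l j) = (\<Sum>k\<le>m. \<Sum>l<n. b k i l * b (m - k) l j)"
        by (rule sum.swap)
      also have "\<dots> = (\<Sum>k\<le>m. of_real (sqrt_coeff k * sqrt_coeff (m - k)) * (B ^\<^sub>m m) $$ (i, j))"
      proof (intro sum.cong refl)
        fix k assume "k \<in> {..m}"
        then have m: "k + (m - k) = m" by simp
        have "(B ^\<^sub>m m) $$ (i, j) = (\<Sum>l<n. (B ^\<^sub>m k) $$ (i, l) * (B ^\<^sub>m (m - k)) $$ (l, j))"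
          by (subst m[symmetric], subst pow_mat_add[OF cB])
            (rule index_mult_mat_sum[OF pow_carrier_mat[OF cB] pow_carrier_mat[OF cB] ij])
        then show "(\<Sum>l<n. b k i l * b (m - k) l j) = of_real (sqrt_coeff k * sqrt_coeff (m - k)) * (B ^\<^sub>m m) $$ (i, j)"
          by (simp add: b_def sum_distrib_left mult_ac)
      qed
      also have "\<dots> = of_real (\<Sum>k\<le>m. sqrt_coeff k * sqrt_coeff (m - k)) * (B ^\<^sub>m m) $$ (i, j)"
        by (simp add: sum_distrib_right)
      also have "\<dots> = (if m \<in> {0,1} then (if m = 0 then 1\<^sub>m n $$ (i, j) else - B $$ (i, j)) else 0)"
        unfolding sqrt_coeff_convolution using cB by auto
      finally show "(\<Sum>l<n. \<Sum>k\<le>m. b k i l * b (m - k) l j) = \<dots>" .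
    qed
    finally have "(\<Sum>l<n. (\<Sum>k. b k i l) * (\<Sum>k. b k l j)) = 1\<^sub>m n $$ (i, j) - B $$ (i, j)"
      using sums_unique2[OF _ sums_If_finite_set[of "{0,1::nat}"]] by fastforce
    also have "\<dots> = C $$ (i, j)" using ij cC by (simp add: B_def)
    also have "(\<Sum>l<n. (\<Sum>k. b k i l) * (\<Sum>k. b k l j)) = (S * S) $$ (i, j)"
      unfolding index_mult_mat_sum[OF cS cS ij] using ij by (simp add: S_def)
    finally show "(S * S) $$ (i, j) = C $$ (i, j)" .
  qed (use cS cC in auto)
  moreover have "psd n S"
    unfolding psd_iff
  proof (intro conjI allI cS)
    fix v
    define t where "t k = Re (inner_vec n v (apply_mat n (B ^\<^sub>m k) v))" for k
    have t: "inner_vec n v (apply_mat n (B ^\<^sub>m k) v) = of_real (t k)" and t0: "0 \<le> t k" for k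
      using effect_pow[OF B, of k]
      unfolding t_def effect_def psd_iff less_eq_complex_def by (simp_all add: complex_eq_iff)
    have "t k \<le> Re (inner_vec n v v)" for k
      using effect_pow[OF B, of k] unfolding effect_iff t_def less_eq_complex_def by auto
    then have t1: "t k \<le> t 0" for k using cB by (simp add: t_def inner_vec_apply_mat_one)
    have "(\<lambda>k. \<Sum>i<n. \<Sum>j<n. cnj (v i) * b k i j * v j)
        sums (\<Sum>i<n. \<Sum>j<n. cnj (v i) * (\<Sum>k. b k i j) * v j)"
      by (intro sums_sum sums_mult sums_mult2 summable_sums summ') auto
    moreover have "(\<Sum>i<n. \<Sum>j<n. cnj (v i) * b k i j * v j) = of_real (sqrt_coeff k * t k)" for k
      unfolding of_real_mult t[symmetric] inner_vec_apply_mat b_def by (simp add: sum_distrib_left mult_ac)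
    moreover have "(\<Sum>i<n. \<Sum>j<n. cnj (v i) * (\<Sum>k. b k i j) * v j) = inner_vec n v (apply_mat n S v)"
      unfolding inner_vec_apply_mat S_def by (intro sum.cong refl) auto
    ultimately have s: "(\<lambda>k. complex_of_real (sqrt_coeff k * t k)) sums inner_vec n v (apply_mat n S v)"
      by simp
    have "(\<lambda>k. sqrt_coeff k * t k) sums Re (inner_vec n v (apply_mat n S v))" "(\<lambda>k. 0) sums Im (inner_vec n v (apply_mat n S v))"
      using sums_Re[OF s] sums_Im[OF s] by simp_all
    with sqrt_coeff_weighted_nonneg[of t, OF t0 t1] sums_unique2[OF _ sums_zero]
    show "0 \<le> inner_vec n v (apply_mat n S v)" unfolding less_eq_complex_def by fastforce
  qed
  ultimately show ?thesis by blast
qed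

text \<open>Replaces the bound of the largest eigenvalue by the trace: the entries satisfy
  \<open>cmod (A $$ (i, j)) \<le> a i * a j\<close>, so the form is dominated by that of the
  rank-one matrix built from \<open>a\<close>, whose squared length is the trace.\<close>

lemma psd_le_trace:
  assumes A: "psd n A"
  shows "Re (inner_vec n v (apply_mat n A v)) \<le> Re (mtrace A) * Re (inner_vec n v v)"
proof -
  have c: "A \<in> carrier_mat n n" using A by (rule psd_carrier)
  define a where "a i = sqrt (Re (A $$ (i, i)))" for i
  have d: "0 \<le> Re (A $$ (i, i))" if "i < n" for i
    using psd_diag_nonneg[OF A that] by (simp add: less_eq_complex_def)
  have e: "cmod (A $$ (i, j)) \<le> a i * a j" if "i < n" "j < n" for i j
    using real_le_rsqrt[OF psd_entry_cauchy_schwarz[OF A that]] by (simp add: a_def real_sqrt_mult)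
  have "Re (inner_vec n v (apply_mat n A v)) \<le> cmod (inner_vec n v (apply_mat n A v))" by (rule complex_Re_le_cmod)
  also have "\<dots> \<le> (\<Sum>i<n. \<Sum>j<n. cmod (cnj (v i) * A $$ (i, j) * v j))"
    unfolding inner_vec_apply_mat by (intro order_trans[OF norm_sum] sum_mono norm_sum)
  also have "\<dots> \<le> (\<Sum>i<n. \<Sum>j<n. (a i * cmod (v i)) * (a j * cmod (v j)))"
  proof (intro sum_mono)
    fix i j assume "i \<in> {..<n}" "j \<in> {..<n}"
    then have "cmod (v i) * cmod (A $$ (i, j)) * cmod (v j) \<le> cmod (v i) * (a i * a j) * cmod (v j)"
      using e by (intro mult_right_mono mult_left_mono) auto
    then show "cmod (cnj (v i) * A $$ (i, j) * v j) \<le> (a i * cmod (v i)) * (a j * cmod (v j))"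
      by (simp add: norm_mult mult_ac)
  qed
  also have "\<dots> = (\<Sum>i<n. a i * cmod (v i))\<^sup>2"
    by (simp add: power2_eq_square sum_product)
  also have "\<dots> \<le> (\<Sum>i<n. (a i)\<^sup>2) * (\<Sum>i<n. (cmod (v i))\<^sup>2)"
    by (rule Cauchy_Schwarz_ineq_sum)
  also have "\<dots> = Re (mtrace A) * Re (inner_vec n v v)"
    using c d by (simp add: a_def mtrace_def inner_vec_self)
  finally show ?thesis .
qed

lemma inner_vec_apply_mat_smult:
  "A \<in> carrier_mat n n \<Longrightarrow> inner_vec n u (apply_mat n (c \<cdot>\<^sub>m A) v) = c * inner_vec n u (apply_mat n A v)"
  by (auto simp: inner_vec_apply_mat sum_distrib_left mult_ac intro!: sum.cong)

lemma psd_smult: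
  assumes "psd n A" "0 \<le> c"
  shows "psd n (of_real c \<cdot>\<^sub>m A)"
  using assms psd_carrier[OF assms(1)]
  by (auto simp: psd_iff inner_vec_apply_mat_smult less_eq_complex_def)

lemma psd_sqrt_exists:
  assumes A: "psd n A"
  shows "\<exists>S. psd n S \<and> S * S = A"
proof -
  have c: "A \<in> carrier_mat n n" using A by (rule psd_carrier)
  \<comment> \<open>The summand 1 keeps the scaling factor positive when \<open>A\<close> is
    zero.\<close>
  define r where "r = Re (mtrace A) + 1"
  have r: "r > 0" using mtrace_nonneg[OF A] by (simp add: r_def less_eq_complex_def)
  define C where "C = of_real (1 / r) \<cdot>\<^sub>m A"
  have cC: "C \<in> carrier_mat n n" using c by (simp add: C_def)
  have "effect n C"
    unfolding effect_iff
  proof (intro conjI allI)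
    show "psd n C" unfolding C_def using A r by (intro psd_smult) auto
    fix v
    have "Re (inner_vec n v (apply_mat n A v)) \<le> r * Re (inner_vec n v v)"
      using psd_le_trace[OF A, of v] inner_vec_self_nonneg[of n v]
      by (simp add: r_def algebra_simps less_eq_complex_def)
    moreover have "Im (inner_vec n v (apply_mat n A v)) = 0" "Im (inner_vec n v v) = 0"
      using A inner_vec_self_nonneg[of n v] unfolding psd_iff less_eq_complex_def by auto
    ultimately show "inner_vec n v (apply_mat n C v) \<le> inner_vec n v v"
      using r unfolding C_def inner_vec_apply_mat_smult[OF c] less_eq_complex_def by (simp add: field_simps)
  qed
  then obtain S where S: "psd n S" "S * S = C" using effect_sqrt_exists by blast
  have cS: "S \<in> carrier_mat n n" using S by (simp add: psd_carrier)
  have "(of_real (sqrt r) \<cdot>\<^sub>m S) * (of_real (sqrt r) \<cdot>\<^sub>m S) = of_real (sqrt r) \<cdot>\<^sub>m (of_real (sqrt r) \<cdot>\<^sub>m C)"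
    unfolding mult_smult_assoc_mat[OF cS smult_carrier_mat[OF cS]] mult_smult_distrib[OF cS cS] S(2) ..
  also have "\<dots> = A"
  proof (rule eq_matI)
    fix i j assume "i < dim_row A" "j < dim_col A"
    moreover have "complex_of_real (sqrt r) * (of_real (sqrt r) * (of_real (1 / r) * x)) = x" for x
      using r unfolding mult.assoc[symmetric] of_real_mult[symmetric] by simp
    ultimately show "(of_real (sqrt r) \<cdot>\<^sub>m (of_real (sqrt r) \<cdot>\<^sub>m C)) $$ (i, j) = A $$ (i, j)"
      using c by (simp add: C_def)
  qed (use c in \<open>auto simp: C_def\<close>)
  finally show ?thesis using psd_smult[OF S(1), of "sqrt r"] r by auto
qed

lemma mat_sqrt:
  assumes "psd n A"
  shows "psd n (mat_sqrt n A)" "mat_sqrt n A * mat_sqrt n A = A"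
proof -
  have "\<exists>!S. psd n S \<and> S * S = A"
    using psd_sqrt_exists[OF assms] psd_sqrt_unique by blast
  from theI'[OF this] show "psd n (mat_sqrt n A)" "mat_sqrt n A * mat_sqrt n A = A"
    unfolding mat_sqrt_def by auto
qed

section \<open>Kronecker products and measurements\<close>

lemma kron_carrier: "A \<in> carrier_mat a a' \<Longrightarrow> B \<in> carrier_mat b b' \<Longrightarrow> kron A B \<in> carrier_mat (a * b) (a' * b')"
  by (simp add: kron_def)

lemma div_mod_less: 
  fixes i :: nat assumes "i < a * b" shows "i div b < a" "i mod b < b"
  using assms less_mult_imp_div_less[of i a b] by (auto intro!: mod_less_divisor Nat.gr0I)

lemma index_kron:
  assumes "A \<in> carrier_mat a a" "B \<in> carrier_mat b b" "i < a * b" "j < a * b"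
  shows "kron A B $$ (i, j) = A $$ (i div b, j div b) * B $$ (i mod b, j mod b)"
  using assms by (simp add: kron_def)

lemma sum_div_mod:
  fixes f :: "nat \<Rightarrow> nat \<Rightarrow> 'a::comm_monoid_add"
  shows "(\<Sum>k<a * b. f (k div b) (k mod b)) = (\<Sum>i<a. \<Sum>j<b. f i j)"
  unfolding sum_mult_product by (intro sum.cong refl) (auto simp: div_mult2_eq)

lemma kron_mult:
  assumes A: "A \<in> carrier_mat a a" and B: "B \<in> carrier_mat b b"
    and C: "C \<in> carrier_mat a a" and D: "D \<in> carrier_mat b b"
  shows "kron A B * kron C D = kron (A * C) (B * D)"
proof (rule eq_matI)
  note K = kron_carrier[OF A B] kron_carrier[OF C D] kron_carrier[OF mult_carrier_mat[OF A C] mult_carrier_mat[OF B D]]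
  show "dim_row (kron A B * kron C D) = dim_row (kron (A * C) (B * D))"
    "dim_col (kron A B * kron C D) = dim_col (kron (A * C) (B * D))"
    using K by auto
  fix i j assume "i < dim_row (kron (A * C) (B * D))" "j < dim_col (kron (A * C) (B * D))"
  then have ij: "i < a * b" "j < a * b" using K by auto
  note d = div_mod_less[OF ij(1)] div_mod_less[OF ij(2)]
  have "(kron A B * kron C D) $$ (i, j)
      = (\<Sum>k<a * b. (A $$ (i div b, k div b) * B $$ (i mod b, k mod b)) * (C $$ (k div b, j div b) * D $$ (k mod b, j mod b)))"
    unfolding index_mult_mat_sum[OF K(1,2) ij] using ij
    by (intro sum.cong refl) (simp add: index_kron[OF A B] index_kron[OF C D])
  also have "\<dots> = (\<Sum>k<a. \<Sum>l<b. (A $$ (i div b, k) * B $$ (i mod b, l)) * (C $$ (k, j div b) * D $$ (l, j mod b)))"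
    by (rule sum_div_mod[of "\<lambda>k l. (A $$ (i div b, k) * B $$ (i mod b, l)) * (C $$ (k, j div b) * D $$ (l, j mod b))"])
  also have "\<dots> = (A * C) $$ (i div b, j div b) * (B * D) $$ (i mod b, j mod b)"
    unfolding index_mult_mat_sum[OF A C d(1,3)] index_mult_mat_sum[OF B D d(2,4)]
    by (simp add: sum_product mult_ac)
  also have "\<dots> = kron (A * C) (B * D) $$ (i, j)"
    by (rule index_kron[OF mult_carrier_mat[OF A C] mult_carrier_mat[OF B D] ij, symmetric])
  finally show "(kron A B * kron C D) $$ (i, j) = kron (A * C) (B * D) $$ (i, j)" .
qed

lemma mtrace_kron:
  assumes A: "A \<in> carrier_mat a a" and B: "B \<in> carrier_mat b b"
  shows "mtrace (kron A B) = mtrace A * mtrace B"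
proof -
  have "mtrace (kron A B) = (\<Sum>k<a * b. A $$ (k div b, k div b) * B $$ (k mod b, k mod b))"
    unfolding mtrace_def using A B kron_carrier[OF A B]
    by (intro sum.cong) (auto simp: index_kron[OF A B])
  also have "\<dots> = (\<Sum>i<a. \<Sum>j<b. A $$ (i, i) * B $$ (j, j))"
    by (rule sum_div_mod[of "\<lambda>i j. A $$ (i, i) * B $$ (j, j)"])
  also have "\<dots> = mtrace A * mtrace B" using A B by (simp add: mtrace_def sum_product)
  finally show ?thesis .
qed

lemma hermitian_mat_kron:
  assumes A: "hermitian_mat a A" and B: "hermitian_mat b B"
  shows "hermitian_mat (a * b) (kron A B)"
  unfolding hermitian_mat_def
proof (intro conjI allI impI)
  note c = hermitian_mat_carrier[OF A] hermitian_mat_carrier[OF B]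
  show "kron A B \<in> carrier_mat (a * b) (a * b)" using c by (rule kron_carrier)
  fix i j assume ij: "i < a * b" "j < a * b"
  note d = div_mod_less[OF ij(1)] div_mod_less[OF ij(2)]
  have "A $$ (j div b, i div b) = cnj (A $$ (i div b, j div b))"
    "B $$ (j mod b, i mod b) = cnj (B $$ (i mod b, j mod b))"
    using A B d unfolding hermitian_mat_def by blast+
  then show "kron A B $$ (j, i) = cnj (kron A B $$ (i, j))"
    unfolding index_kron[OF c ij] index_kron[OF c ij(2,1)] by simp
qed

text \<open>The Kronecker product of the roots is Hermitian and squares to
  \<open>kron A B\<close>.\<close>

lemma psd_kron:
  assumes A: "psd a A" and B: "psd b B"
  shows "psd (a * b) (kron A B)"
proof -
  obtain S R where S: "psd a S" "S * S = A" and R: "psd b R" "R * R = B"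
    using psd_sqrt_exists assms by meson
  have "kron S R * kron S R = kron A B"
    using kron_mult[of S a R b S R] S R psd_carrier by metis
  then show ?thesis
    using hermitian_mat_square_psd[OF hermitian_mat_kron[OF psd_hermitian_mat[OF S(1)] psd_hermitian_mat[OF R(1)]]] by simp
qed

text \<open>The product itself need not be Hermitian, but by cyclicity its trace is that of
  \<open>S * B * S\<close> with \<open>S\<close> a root of \<open>A\<close>.\<close>

lemma psd_mult_trace_nonneg:
  assumes A: "psd n A" and B: "psd n B"
  shows "0 \<le> mtrace (A * B)"
proof -
  obtain S where S: "psd n S" "S * S = A" using psd_sqrt_exists A by blast
  note c = psd_carrier[OF S(1)] psd_carrier[OF B]
  have "A * B = S * (S * B)" using S(2) assoc_mult_mat[OF c(1) c(1) c(2)] by simp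
  then have "mtrace (A * B) = mtrace (S * B * S)"
    using mtrace_comm[OF c(1) mult_carrier_mat[OF c]] by simp
  then show ?thesis using mtrace_nonneg[OF psd_sandwich[OF B psd_hermitian_mat[OF S(1)]]] by simp
qed

lemma tensor_word_Nil [simp]: "tensor_word W [] = 1\<^sub>m 1"
  by (simp add: tensor_word_def)

lemma tensor_word_Cons [simp]: "tensor_word W (x # xs) = kron (W x) (tensor_word W xs)"
  by (simp add: tensor_word_def)

lemma tensor_word_carrier:
  assumes "\<And>x. x \<in> set xs \<Longrightarrow> W x \<in> carrier_mat d d"
  shows "tensor_word W xs \<in> carrier_mat (d ^ length xs) (d ^ length xs)"
  using assms by (induction xs) (auto intro!: kron_carrier simp del: One_nat_def)

lemma psd_tensor_word:
  assumes "\<And>x. x \<in> set xs \<Longrightarrow> psd d (W x)"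
  shows "psd (d ^ length xs) (tensor_word W xs)"
  using assms by (induction xs) (auto intro!: psd_kron psd_one simp del: One_nat_def)

lemma tensor_word_mult:
  assumes "length xs = length ys" "\<And>x. x \<in> set xs \<Longrightarrow> W x \<in> carrier_mat d d"
    "\<And>y. y \<in> set ys \<Longrightarrow> V y \<in> carrier_mat d d"
  shows "tensor_word W xs * tensor_word V ys = tensor_word (\<lambda>(x, y). W x * V y) (zip xs ys)"
  using assms
proof (induction xs ys rule: list_induct2)
  case (Cons x xs y ys)
  have "tensor_word W xs \<in> carrier_mat (d ^ length xs) (d ^ length xs)"
    using Cons.prems by (intro tensor_word_carrier) auto
  moreover have "tensor_word V ys \<in> carrier_mat (d ^ length xs) (d ^ length xs)"
    unfolding Cons.hyps using Cons.prems by (intro tensor_word_carrier) auto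
  moreover have "W x \<in> carrier_mat d d" "V y \<in> carrier_mat d d" using Cons.prems by auto
  ultimately have "kron (W x) (tensor_word W xs) * kron (V y) (tensor_word V ys)
      = kron (W x * V y) (tensor_word W xs * tensor_word V ys)"
    by (intro kron_mult)
  then show ?case using Cons by simp
qed simp

lemma mtrace_one: "mtrace (1\<^sub>m n) = of_nat n"
  by (simp add: mtrace_def)

lemma mtrace_tensor_word:
  assumes "\<And>x. x \<in> set xs \<Longrightarrow> W x \<in> carrier_mat d d"
  shows "mtrace (tensor_word W xs) = (\<Prod>x\<leftarrow>xs. mtrace (W x))"
  using assms
proof (induction xs)
  case Nil
  then show ?case by (simp add: mtrace_one del: One_nat_def)
next
  case (Cons x xs)
  then show ?case using mtrace_kron[of "W x" d "tensor_word W xs" "d ^ length xs"]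
    tensor_word_carrier[of xs W d] by simp
qed

lemma mtrace_tensor_word_mult:
  assumes "length xs = length ys" "\<And>x. x \<in> set xs \<Longrightarrow> W x \<in> carrier_mat d d"
    "\<And>y. y \<in> set ys \<Longrightarrow> V y \<in> carrier_mat d d"
  shows "mtrace (tensor_word W xs * tensor_word V ys) = (\<Prod>(x, y)\<leftarrow>zip xs ys. mtrace (W x * V y))"
proof -
  have "mtrace (tensor_word (\<lambda>(x, y). W x * V y) (zip xs ys)) = (\<Prod>z\<leftarrow>zip xs ys. mtrace (case z of (x, y) \<Rightarrow> W x * V y))"
  proof (rule mtrace_tensor_word[of _ _ d])
    fix z assume "z \<in> set (zip xs ys)"
    then have "fst z \<in> set xs" "snd z \<in> set ys"
      by (metis prod.collapse set_zip_leftD set_zip_rightD)+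
    from mult_carrier_mat[OF assms(2)[OF this(1)] assms(3)[OF this(2)]]
    show "(case z of (x, y) \<Rightarrow> W x * V y) \<in> carrier_mat d d" by (simp add: case_prod_unfold)
  qed
  then show ?thesis
    by (subst tensor_word_mult[OF assms(1), of W d V]) (simp_all add: assms(2,3) case_prod_unfold)
qed

section \<open>Sums over words and completeness of product measurements\<close>

abbreviation words :: "'a set \<Rightarrow> nat \<Rightarrow> 'a list set" where
  "words A n \<equiv> {xs. set xs \<subseteq> A \<and> length xs = n}"

lemma sum_words_Suc:
  assumes "finite A"
  shows "(\<Sum>xs\<in>words A (Suc n). f xs) = (\<Sum>x\<in>A. \<Sum>xs\<in>words A n. f (x # xs))"
proof -
  have eq: "words A (Suc n) = (\<lambda>(x, xs). x # xs) ` (A \<times> words A n)"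
    by (force simp: length_Suc_conv image_iff)
  show ?thesis
    unfolding eq sum.cartesian_product
    by (subst sum.reindex) (auto simp: inj_on_def case_prod_unfold)
qed

lemma msum_tensor_word:
  assumes A: "finite A" and V: "\<And>y. y \<in> A \<Longrightarrow> V y \<in> carrier_mat d d" and s: "msum d V A = 1\<^sub>m d"
  shows "msum (d ^ n) (tensor_word V) (words A n) = 1\<^sub>m (d ^ n)"
proof (induction n)
  case 0
  have w: "words A 0 = {[]}" by auto
  show ?case unfolding msum_def w by (intro eq_matI) (simp_all del: One_nat_def)
next
  case (Suc n)
  show ?case
  proof (rule eq_matI)
    fix i j assume "i < dim_row (1\<^sub>m (d ^ Suc n) :: complex mat)" "j < dim_col (1\<^sub>m (d ^ Suc n) :: complex mat)"
    then have ij: "i < d * d ^ n" "j < d * d ^ n" by (simp_all only: index_one_mat power_Suc)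
    note m = div_mod_less[OF ij(1)] div_mod_less[OF ij(2)]
    have e: "tensor_word V (y # ys) $$ (i, j) = V y $$ (i div d^n, j div d^n) * tensor_word V ys $$ (i mod d^n, j mod d^n)"
      if "y \<in> A" "ys \<in> words A n" for y ys
    proof -
      have "tensor_word V ys \<in> carrier_mat (d ^ n) (d ^ n)"
        using tensor_word_carrier[of ys V d] V that by blast
      from index_kron[OF V[OF that(1)] this ij] show ?thesis by simp
    qed
    have "msum (d ^ Suc n) (tensor_word V) (words A (Suc n)) $$ (i, j)
        = (\<Sum>y\<in>A. \<Sum>ys\<in>words A n. tensor_word V (y # ys) $$ (i, j))"
      using ij unfolding msum_def sum_words_Suc[OF A] by (simp del: tensor_word_Cons)
    also have "\<dots> = (\<Sum>y\<in>A. V y $$ (i div d^n, j div d^n)) * (\<Sum>ys\<in>words A n. tensor_word V ys $$ (i mod d^n, j mod d^n))"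
      unfolding sum_product by (intro sum.cong refl e)
    also have "(\<Sum>y\<in>A. V y $$ (i div d^n, j div d^n)) = msum d V A $$ (i div d^n, j div d^n)"
      using m by (simp add: msum_def)
    also have "(\<Sum>ys\<in>words A n. tensor_word V ys $$ (i mod d^n, j mod d^n))
        = msum (d ^ n) (tensor_word V) (words A n) $$ (i mod d^n, j mod d^n)"
      using m by (simp add: msum_def)
    also have "msum d V A $$ (i div d^n, j div d^n) * \<dots> = 1\<^sub>m (d ^ Suc n) $$ (i, j)"
    proof -
      have "i div d^n = j div d^n \<and> i mod d^n = j mod d^n \<longleftrightarrow> i = j"
        by (metis div_mult_mod_eq)
      then show ?thesis unfolding s Suc.IH using m ij by auto
    qed
    finally show "msum (d ^ Suc n) (tensor_word V) (words A (Suc n)) $$ (i, j) = 1\<^sub>m (d ^ Suc n) $$ (i, j)" .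
  qed (simp_all add: msum_def)
qed

lemma msum_carrier: "msum n f S \<in> carrier_mat n n"
  by (simp add: msum_def)

lemma inner_vec_apply_mat_msum: "inner_vec n u (apply_mat n (msum n f S) v) = (\<Sum>m\<in>S. inner_vec n u (apply_mat n (f m) v))"
proof -
  have "inner_vec n u (apply_mat n (msum n f S) v) = (\<Sum>i<n. \<Sum>j<n. \<Sum>m\<in>S. cnj (u i) * f m $$ (i, j) * v j)"
    unfolding inner_vec_apply_mat msum_def by (intro sum.cong refl) (simp add: sum_distrib_left sum_distrib_right)
  also have "\<dots> = (\<Sum>i<n. \<Sum>m\<in>S. \<Sum>j<n. cnj (u i) * f m $$ (i, j) * v j)"
    by (intro sum.cong refl) (rule sum.swap)
  also have "\<dots> = (\<Sum>m\<in>S. \<Sum>i<n. \<Sum>j<n. cnj (u i) * f m $$ (i, j) * v j)"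
    by (rule sum.swap)
  finally show ?thesis unfolding inner_vec_apply_mat .
qed

lemma psd_msum: "(\<And>m. m \<in> S \<Longrightarrow> psd n (f m)) \<Longrightarrow> psd n (msum n f S)"
  unfolding psd_iff by (auto simp: inner_vec_apply_mat_msum msum_carrier intro!: sum_nonneg)

lemma povm_effect:
  assumes "povm n S D" "M \<subseteq> S"
  shows "effect n (msum n D M)"
proof -
  have "1\<^sub>m n - msum n D M = msum n D (S - M)"
  proof (rule eq_matI)
    fix i j assume "i < dim_row (msum n D (S - M))" "j < dim_col (msum n D (S - M))"
    then have ij: "i < n" "j < n" by (auto simp: msum_def)
    have "1\<^sub>m n $$ (i, j) = msum n D S $$ (i, j)" using assms by (simp add: povm_def)
    also have "\<dots> = (\<Sum>m\<in>S. D m $$ (i, j))" using ij by (simp add: msum_def)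
    finally show "(1\<^sub>m n - msum n D M) $$ (i, j) = msum n D (S - M) $$ (i, j)"
      using ij assms sum_diff[of S M "\<lambda>m. D m $$ (i, j)"] by (simp add: msum_def povm_def)
  qed (auto simp: msum_def)
  moreover have "psd n (msum n D M)" "psd n (msum n D (S - M))"
    using assms by (auto intro!: psd_msum simp: povm_def)
  ultimately show ?thesis by (simp add: effect_def)
qed

lemma mtrace_mult_msum:
  assumes A: "A \<in> carrier_mat n n" and f: "\<And>m. m \<in> S \<Longrightarrow> f m \<in> carrier_mat n n"
  shows "mtrace (A * msum n f S) = (\<Sum>m\<in>S. mtrace (A * f m))"
proof -
  have "mtrace (A * msum n f S) = (\<Sum>i<n. \<Sum>k<n. \<Sum>m\<in>S. A $$ (i, k) * f m $$ (k, i))"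
    using A by (simp add: mtrace_def index_mult_mat_sum[OF A msum_carrier] del: index_mult_mat(1))
      (simp add: msum_def sum_distrib_left)
  also have "\<dots> = (\<Sum>i<n. \<Sum>m\<in>S. \<Sum>k<n. A $$ (i, k) * f m $$ (k, i))"
    by (intro sum.cong refl) (rule sum.swap)
  also have "\<dots> = (\<Sum>m\<in>S. \<Sum>i<n. \<Sum>k<n. A $$ (i, k) * f m $$ (k, i))"
    by (rule sum.swap)
  also have "\<dots> = (\<Sum>m\<in>S. mtrace (A * f m))"
    using A f by (intro sum.cong refl) (simp add: mtrace_def index_mult_mat_sum[OF A f] del: index_mult_mat(1))
  finally show ?thesis .
qed

section \<open>Classical identification codes\<close>

lemma sum_length_Suc:
  fixes f :: "'a::finite list \<Rightarrow> 'b::comm_monoid_add"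
  shows "(\<Sum>xs | length xs = Suc n. f xs) = (\<Sum>x\<in>UNIV. \<Sum>xs | length xs = n. f (x # xs))"
  using sum_words_Suc[of UNIV f n] by simp

text \<open>The Gilbert-Varshamov argument: the neighbourhoods of a maximal separated set cover
  \<open>S\<close>, since an uncovered point could be added.\<close>

lemma separated_subset_exists:
  assumes S: "finite S" and refl: "\<And>x. x \<in> S \<Longrightarrow> B x x" and sym: "\<And>x y. B x y \<Longrightarrow> B y x"
    and V: "\<And>x. x \<in> S \<Longrightarrow> real (card {y \<in> S. B x y}) \<le> V"
  shows "\<exists>C\<subseteq>S. (\<forall>x\<in>C. \<forall>y\<in>C. x \<noteq> y \<longrightarrow> \<not> B x y) \<and> real (card S) \<le> real (card C) * V"
proof -
  define P where "P = {C. C \<subseteq> S \<and> (\<forall>x\<in>C. \<forall>y\<in>C. x \<noteq> y \<longrightarrow> \<not> B x y)}"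
  have "finite P" unfolding P_def using S by simp
  moreover have "{} \<in> P" by (simp add: P_def)
  ultimately obtain C where C: "C \<in> P" and max: "\<And>D. D \<in> P \<Longrightarrow> C \<subseteq> D \<Longrightarrow> C = D"
    using finite_has_maximal[of P] by blast
  have CS: "C \<subseteq> S" "finite C" using C S finite_subset unfolding P_def by auto
  have "S \<subseteq> (\<Union>x\<in>C. {y \<in> S. B x y})"
  proof
    fix y assume y: "y \<in> S"
    show "y \<in> (\<Union>x\<in>C. {y \<in> S. B x y})"
    proof (rule ccontr)
      assume n: "y \<notin> (\<Union>x\<in>C. {y \<in> S. B x y})"
      then have "insert y C \<in> P" using C y sym unfolding P_def by blast
      with max have "y \<in> C" by blast
      with n y refl show False by blast
    qed
  qed
  then have "card S \<le> card (\<Union>x\<in>C. {y \<in> S. B x y})"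
    using CS S by (intro card_mono) auto
  also have "\<dots> \<le> (\<Sum>x\<in>C. card {y \<in> S. B x y})" by (rule card_UN_le) (rule CS)
  finally have "real (card S) \<le> (\<Sum>x\<in>C. real (card {y \<in> S. B x y}))"
    by (metis of_nat_le_iff of_nat_sum)
  also have "\<dots> \<le> (\<Sum>x\<in>C. V)" using CS by (intro sum_mono V) auto
  finally show ?thesis using C unfolding P_def by auto
qed

lemma large_fibre_exists:
  fixes h :: "'a \<Rightarrow> nat"
  assumes S: "finite S" and h: "\<And>x. x \<in> S \<Longrightarrow> h x \<le> L"
  shows "\<exists>k. card S \<le> (L + 1) * card {x \<in> S. h x = k}"
proof (rule ccontr)
  assume "\<not> ?thesis"
  then have lt: "(L + 1) * card {x \<in> S. h x = k} < card S" for k by (simp add: not_le)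
  have "S = (\<Union>k\<in>{..L}. {x \<in> S. h x = k})" using h by auto
  then have "card S = (\<Sum>k\<le>L. card {x \<in> S. h x = k})"
    using S by (subst card_UN_disjoint[symmetric]) auto
  then have "(L + 1) * card S = (\<Sum>k\<le>L. (L + 1) * card {x \<in> S. h x = k})"
    by (simp add: sum_distrib_left)
  also have "\<dots> < (\<Sum>k\<le>L. card S)" using lt by (intro sum_strict_mono) auto
  finally show False by simp
qed

section \<open>Hamming distance and the volume of Hamming balls\<close>

definition hamming :: "'a list \<Rightarrow> 'a list \<Rightarrow> nat" where
  "hamming u v = length (filter (\<lambda>(x, y). x \<noteq> y) (zip u v))"

lemma hamming_simps [simp]: "hamming [] v = 0" "hamming (x # u) (y # v) = of_bool (x \<noteq> y) + hamming u v"
  by (simp_all add: hamming_def)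

lemma hamming_self [simp]: "hamming u u = 0"
  by (induction u) auto

lemma hamming_commute: "hamming u v = hamming v u"
proof (induction u arbitrary: v)
  case Nil
  then show ?case by (simp add: hamming_def)
next
  case (Cons x u)
  then show ?case by (cases v) (auto simp: hamming_def)
qed

lemma finite_words: "finite A \<Longrightarrow> finite (words A n)"
  by (rule finite_lists_length_eq)

text \<open>The sum factors over positions. With weight \<open>1 / card A\<close> per disagreement,
  a position contributes 1 for agreement and less than 1 for all disagreements together.\<close>

lemma sum_hamming_le:
  assumes A: "finite A" and u: "u \<in> words A n"
  shows "(\<Sum>v\<in>words A n. (1 / real (card A)) ^ hamming u v) \<le> 2 ^ n"
  using u
proof (induction n arbitrary: u)
  case 0
  then have "words A 0 = {[]}" by auto
  then show ?case using 0 by simp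
next
  case (Suc n)
  then obtain x u' where u: "u = x # u'" and x: "x \<in> A" and u': "u' \<in> words A n"
    by (auto simp: length_Suc_conv)
  define r where "r = 1 / real (card A)"
  have q: "real (card A) > 0" using A x by (auto simp: card_gt_0_iff)
  have "(\<Sum>v\<in>words A (Suc n). r ^ hamming u v) = (\<Sum>y\<in>A. \<Sum>v\<in>words A n. r ^ of_bool (x \<noteq> y) * r ^ hamming u' v)"
    unfolding sum_words_Suc[OF A] u by (simp add: power_add)
  also have "\<dots> = (\<Sum>y\<in>A. r ^ of_bool (x \<noteq> y)) * (\<Sum>v\<in>words A n. r ^ hamming u' v)"
    by (simp add: sum_product)
  also have "\<dots> \<le> 2 * 2 ^ n"
  proof (rule mult_mono)
    have "(\<Sum>y\<in>A. r ^ of_bool (x \<noteq> y)) = 1 + (\<Sum>y\<in>A - {x}. r ^ of_bool (x \<noteq> y))"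
      using A x by (subst sum.remove[of _ x]) auto
    also have "(\<Sum>y\<in>A - {x}. r ^ of_bool (x \<noteq> y)) = (\<Sum>y\<in>A - {x}. r)" by (intro sum.cong) auto
    also have "\<dots> \<le> 1" using A x q by (simp add: r_def field_simps)
    finally show "(\<Sum>y\<in>A. r ^ of_bool (x \<noteq> y)) \<le> 2" by simp
  qed (use Suc.IH[OF u'] q in \<open>auto simp: r_def intro!: sum_nonneg\<close>)
  finally show ?case by (simp add: r_def)
qed

text \<open>An exponential Markov inequality: every word in the ball has weight at least
  \<open>card A powr - (t * n)\<close> in the preceding sum.\<close>

lemma hamming_ball_card_le:
  assumes A: "finite A" and u: "u \<in> words A n" and ne: "A \<noteq> {}" and t: "0 \<le> t"
  shows "real (card {v \<in> words A n. real (hamming u v) < t * real n}) \<le> 2 ^ n * real (card A) powr (t * real n)"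
proof -
  define q where "q = real (card A)"
  have q: "q \<ge> 1" using A ne by (simp add: q_def Suc_le_eq card_gt_0_iff)
  let ?B = "{v \<in> words A n. real (hamming u v) < t * real n}"
  have "real (card ?B) * (q powr - (t * real n)) = (\<Sum>v\<in>?B. q powr - (t * real n))" by simp
  also have "\<dots> \<le> (\<Sum>v\<in>?B. (1 / q) ^ hamming u v)"
  proof (intro sum_mono)
    fix v assume "v \<in> ?B"
    then have "q powr - (t * real n) \<le> q powr - real (hamming u v)" using q by (intro powr_mono) auto
    also have "\<dots> = (1 / q) ^ hamming u v"
      using q by (simp add: powr_minus powr_realpow power_one_over inverse_eq_divide)
    finally show "q powr - (t * real n) \<le> (1 / q) ^ hamming u v" .
  qed
  also have "\<dots> \<le> (\<Sum>v\<in>words A n. (1 / q) ^ hamming u v)"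
    using q finite_words[OF A] by (intro sum_mono2) auto
  also have "\<dots> \<le> 2 ^ n" unfolding q_def by (rule sum_hamming_le[OF A u])
  finally show ?thesis using q by (simp add: q_def powr_minus field_simps)
qed

text \<open>With \<open>s = sqrt x\<close> the left side is \<open>4 * (s * ln s)\<^sup>2\<close>.
  The bound makes the variance of a log-likelihood uniform over all letters, although output
  probabilities may be arbitrarily small.\<close>

lemma xlnx_sq_le: 
  fixes x :: real
  assumes "0 \<le> x" "x \<le> 1"
  shows "x * (ln x)\<^sup>2 \<le> 4"
proof (cases "x = 0")
  case False
  define s where "s = sqrt x"
  have s: "0 < s" "s \<le> 1" "x = s\<^sup>2" using assms False by (auto simp: s_def)
  have "- ln s \<le> 1 / s - 1" using ln_le_minus_one[of "1 / s"] s by (simp add: ln_div)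
  then have "- ln s * s \<le> 1" using s by (simp add: field_simps)
  moreover have "0 \<le> - ln s * s" using s by (simp add: mult_nonpos_nonneg)
  ultimately have "(- ln s * s)\<^sup>2 \<le> 1\<^sup>2" by (intro power_mono) auto
  moreover have "ln x = 2 * ln s" using s by (simp add: ln_realpow)
  ultimately show ?thesis unfolding s(3) by (simp add: power_mult_distrib mult.commute)
qed simp

lemma xlnx_le: 
  fixes x :: real
  assumes "0 \<le> x" "x \<le> 1"
  shows "0 \<le> - x * ln x" "- x * ln x \<le> 1"
proof -
  show "0 \<le> - x * ln x" using assms by (cases "x = 0") (auto simp: mult_nonneg_nonpos)
  show "- x * ln x \<le> 1"
  proof (cases "x = 0")
    case False
    then have "- ln x \<le> 1 / x - 1" using ln_le_minus_one[of "1 / x"] assms by (simp add: ln_div)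
    then show ?thesis using assms False by (simp add: field_simps)
  qed simp
qed

section \<open>Memoryless classical channels: typical outputs, fidelity and codes\<close>

locale dmc =
  fixes X :: "'x set" and p :: "'x \<Rightarrow> 'y::finite \<Rightarrow> real"
  assumes p_nonneg: "x \<in> X \<Longrightarrow> 0 \<le> p x y"
    and p_sum: "x \<in> X \<Longrightarrow> (\<Sum>y\<in>UNIV. p x y) = 1"
begin

definition word_prob :: "'x list \<Rightarrow> 'y list \<Rightarrow> real" where
  "word_prob xs ys = (\<Prod>(x, y)\<leftarrow>zip xs ys. p x y)"

definition letter_entropy :: "'x \<Rightarrow> real" where
  "letter_entropy x = (\<Sum>y\<in>UNIV. - p x y * ln (p x y))"

definition word_entropy :: "'x list \<Rightarrow> real" where
  "word_entropy xs = (\<Sum>x\<leftarrow>xs. letter_entropy x)"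

text \<open>The log-likelihood with its mean subtracted: under \<open>word_prob xs\<close> the
  positions contribute independent terms of mean 0.\<close>

definition entropy_dev :: "'x list \<Rightarrow> 'y list \<Rightarrow> real" where
  "entropy_dev xs ys = (\<Sum>(x, y)\<leftarrow>zip xs ys. - ln (p x y) - letter_entropy x)"

definition bhattacharyya :: "'x \<Rightarrow> 'x \<Rightarrow> real" where
  "bhattacharyya x x' = (\<Sum>y\<in>UNIV. sqrt (p x y * p x' y))"

text \<open>As \<open>ln 0 = 0\<close>, the deviation says nothing about outputs of probability 0;
  they are excluded explicitly so that the probability of a typical output can be recovered from the
  entropy and the deviation.\<close>

definition typical_set :: "real \<Rightarrow> 'x list \<Rightarrow> 'y list set" where
  "typical_set a xs = {ys \<in> words UNIV (length xs). 0 < word_prob xs ys \<and> \<bar>entropy_dev xs ys\<bar> < a}"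

lemma word_prob_simps [simp]: "word_prob [] ys = 1" "word_prob (x # xs) (y # ys) = p x y * word_prob xs ys"
  by (simp_all add: word_prob_def)

lemma entropy_dev_simps [simp]: "entropy_dev [] ys = 0" "entropy_dev (x # xs) (y # ys) = - ln (p x y) - letter_entropy x + entropy_dev xs ys"
  by (simp_all add: entropy_dev_def)

lemma word_entropy_simps [simp]: "word_entropy [] = 0" "word_entropy (x # xs) = letter_entropy x + word_entropy xs"
  by (simp_all add: word_entropy_def)

lemma p_le_1:
  assumes "x \<in> X" shows "p x y \<le> 1"
proof -
  have "p x y \<le> (\<Sum>y\<in>UNIV. p x y)" using assms p_nonneg by (intro member_le_sum) auto
  then show ?thesis using p_sum assms by simp
qed

lemma letter_entropy_bounds: 
  assumes "x \<in> X" shows "0 \<le> letter_entropy x" "letter_entropy x \<le> CARD('y)"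
proof -
  show "0 \<le> letter_entropy x" unfolding letter_entropy_def using assms p_nonneg p_le_1 by (intro sum_nonneg xlnx_le) auto
  have "letter_entropy x \<le> (\<Sum>y\<in>(UNIV::'y set). 1)" 
    unfolding letter_entropy_def using assms p_nonneg p_le_1 by (intro sum_mono xlnx_le) auto
  then show "letter_entropy x \<le> CARD('y)" by simp
qed

lemma word_entropy_bounds: 
  assumes "set xs \<subseteq> X" shows "0 \<le> word_entropy xs" "word_entropy xs \<le> real (length xs) * CARD('y)"
  using assms by (induction xs) (auto dest: letter_entropy_bounds simp: algebra_simps add_mono)

lemma word_prob_nonneg: "set xs \<subseteq> X \<Longrightarrow> 0 \<le> word_prob xs ys"
proof (induction xs arbitrary: ys)
  case (Cons x xs)
  then show ?case by (cases ys) (auto simp: p_nonneg word_prob_def)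
qed simp

lemma words_UNIV_0: "words (UNIV :: 'y set) 0 = {[]}"
  by auto

lemma word_prob_sum: "set xs \<subseteq> X \<Longrightarrow> (\<Sum>ys\<in>words UNIV (length xs). word_prob xs ys) = 1"
  by (induction xs) (simp_all add: sum_length_Suc p_sum flip: sum_distrib_left sum_distrib_right)

text \<open>Variances of independent terms add up: the cross term in the induction carries the
  factor \<open>\<Sum>y. p x y * ?g y\<close>, which is 0.\<close>

lemma entropy_dev_second_moment:
  "set xs \<subseteq> X \<Longrightarrow> (\<Sum>ys\<in>words UNIV (length xs). word_prob xs ys * (entropy_dev xs ys)\<^sup>2) \<le> 4 * CARD('y) * real (length xs)"
proof (induction xs)
  case (Cons x xs)
  then have x: "x \<in> X" and xs: "set xs \<subseteq> X" by auto
  let ?S = "words (UNIV :: 'y set) (length xs)"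
  let ?g = "\<lambda>y. - ln (p x y) - letter_entropy x"
  have g1: "(\<Sum>y\<in>UNIV. p x y * ?g y) = 0"
    using p_sum[OF x] by (simp add: right_diff_distrib sum_subtractf letter_entropy_def flip: sum_distrib_right)
  \<comment> \<open>Second moment minus squared mean, arranged so that the centred sum
    \<open>g1\<close> can be substituted.\<close>
  have "(\<Sum>y\<in>UNIV. p x y * (?g y)\<^sup>2) = (\<Sum>y\<in>UNIV. p x y * (ln (p x y))\<^sup>2 - letter_entropy x * (p x y * ?g y) - letter_entropy x * (- p x y * ln (p x y)))"
    by (intro sum.cong refl) (simp add: power2_eq_square algebra_simps)
  also have "\<dots> = (\<Sum>y\<in>UNIV. p x y * (ln (p x y))\<^sup>2) - letter_entropy x * (\<Sum>y\<in>UNIV. p x y * ?g y) - letter_entropy x * letter_entropy x"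
    unfolding sum_subtractf sum_distrib_left[symmetric] letter_entropy_def[symmetric] ..
  also have "\<dots> \<le> (\<Sum>y\<in>UNIV. p x y * (ln (p x y))\<^sup>2)" using g1 by simp
  also have "\<dots> \<le> (\<Sum>y\<in>(UNIV::'y set). 4)"
    using p_nonneg[OF x] p_le_1[OF x] by (intro sum_mono xlnx_sq_le)
  finally have g2: "(\<Sum>y\<in>UNIV. p x y * (?g y)\<^sup>2) \<le> 4 * CARD('y)" by simp
  have "(\<Sum>ys\<in>words UNIV (length (x # xs)). word_prob (x # xs) ys * (entropy_dev (x # xs) ys)\<^sup>2)
      = (\<Sum>y\<in>UNIV. \<Sum>ys\<in>?S. p x y * (?g y)\<^sup>2 * word_prob xs ys + 2 * (p x y * ?g y * (word_prob xs ys * entropy_dev xs ys))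
           + p x y * (word_prob xs ys * (entropy_dev xs ys)\<^sup>2))"
    by (simp add: sum_length_Suc) (intro sum.cong refl, simp add: power2_eq_square algebra_simps)
  also have "\<dots> = (\<Sum>y\<in>UNIV. p x y * (?g y)\<^sup>2) * (\<Sum>ys\<in>?S. word_prob xs ys)
      + 2 * ((\<Sum>y\<in>UNIV. p x y * ?g y) * (\<Sum>ys\<in>?S. word_prob xs ys * entropy_dev xs ys))
      + (\<Sum>y\<in>UNIV. p x y) * (\<Sum>ys\<in>?S. word_prob xs ys * (entropy_dev xs ys)\<^sup>2)"
    unfolding sum_product unfolding sum_distrib_left unfolding sum.distrib ..
  also have "\<dots> \<le> 4 * CARD('y) + 4 * CARD('y) * real (length xs)"
    using g1 g2 Cons.IH[OF xs] word_prob_sum[OF xs] p_sum[OF x] by simp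
  finally show ?case by (simp add: algebra_simps)
qed (simp add: words_UNIV_0)

lemma word_prob_eq_exp:
  assumes "set xs \<subseteq> X" "length xs = length ys" "0 < word_prob xs ys"
  shows "word_prob xs ys = exp (- (word_entropy xs + entropy_dev xs ys))"
  using assms(2,1,3)
proof (induction xs ys rule: list_induct2)
  case (Cons x xs y ys)
  then have "0 \<le> p x y" "0 \<le> word_prob xs ys" "0 < p x y * word_prob xs ys" by (auto intro: p_nonneg word_prob_nonneg)
  then have pos: "0 < p x y" "0 < word_prob xs ys" by (auto simp: zero_less_mult_iff)
  then have "word_prob xs ys = exp (- (word_entropy xs + entropy_dev xs ys))" using Cons by auto
  with pos show ?case by (simp add: exp_add exp_diff exp_minus field_simps)
qed simp

text \<open>Chebyshev's inequality. Atypical outputs have probability 0 or a deviation of at least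
  \<open>a\<close>.\<close>

lemma typical_set_prob:
  assumes xs: "set xs \<subseteq> X" and a: "0 < a"
  shows "1 - 4 * CARD('y) * real (length xs) / a\<^sup>2 \<le> (\<Sum>ys\<in>typical_set a xs. word_prob xs ys)"
proof -
  let ?S = "words (UNIV :: 'y set) (length xs)"
  have fin: "finite ?S" by (rule finite_words) simp
  have sub: "typical_set a xs \<subseteq> ?S" by (auto simp: typical_set_def)
  have "(\<Sum>ys\<in>?S - typical_set a xs. word_prob xs ys) \<le> (\<Sum>ys\<in>?S - typical_set a xs. word_prob xs ys * (entropy_dev xs ys)\<^sup>2 / a\<^sup>2)"
  proof (intro sum_mono)
    fix ys assume ys: "ys \<in> ?S - typical_set a xs"
    show "word_prob xs ys \<le> word_prob xs ys * (entropy_dev xs ys)\<^sup>2 / a\<^sup>2"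
    proof (cases "word_prob xs ys = 0")
      case False
      then have "a \<le> \<bar>entropy_dev xs ys\<bar>" using ys word_prob_nonneg[OF xs, of ys] by (auto simp: typical_set_def)
      then have "a\<^sup>2 \<le> (entropy_dev xs ys)\<^sup>2" using a by (metis abs_le_square_iff abs_of_pos)
      then have "1 \<le> (entropy_dev xs ys)\<^sup>2 / a\<^sup>2" using a by simp
      then show ?thesis using mult_left_mono[OF _ word_prob_nonneg[OF xs, of ys]] by fastforce
    qed simp
  qed
  also have "\<dots> \<le> (\<Sum>ys\<in>?S. word_prob xs ys * (entropy_dev xs ys)\<^sup>2 / a\<^sup>2)"
    using fin word_prob_nonneg[OF xs] by (intro sum_mono2) auto
  also have "\<dots> \<le> 4 * CARD('y) * real (length xs) / a\<^sup>2"
    unfolding sum_divide_distrib[symmetric] using entropy_dev_second_moment[OF xs] by (intro divide_right_mono) auto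
  finally show ?thesis using sum.subset_diff[OF sub fin, of "word_prob xs"] word_prob_sum[OF xs] by simp
qed

lemma bhattacharyya_word:
  assumes "length u = length v" "set u \<subseteq> X" "set v \<subseteq> X"
  shows "(\<Sum>ys\<in>words UNIV (length u). sqrt (word_prob u ys * word_prob v ys)) = (\<Prod>(x, x')\<leftarrow>zip u v. bhattacharyya x x')"
  using assms
proof (induction u v rule: list_induct2)
  case (Cons x u x' v)
  have "(\<Sum>ys\<in>words UNIV (length (x # u)). sqrt (word_prob (x # u) ys * word_prob (x' # v) ys))
      = (\<Sum>y\<in>UNIV. \<Sum>ys\<in>words UNIV (length u). sqrt (p x y * p x' y) * sqrt (word_prob u ys * word_prob v ys))"
    by (simp add: sum_length_Suc real_sqrt_mult mult_ac)
  also have "\<dots> = bhattacharyya x x' * (\<Sum>ys\<in>words UNIV (length u). sqrt (word_prob u ys * word_prob v ys))"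
    by (simp add: bhattacharyya_def sum_product)
  finally show ?case using Cons by simp
qed (simp add: words_UNIV_0)

text \<open>The squared Euclidean distance of the vectors of root probabilities is
  \<open>2 - 2 * bhattacharyya x x'\<close>, which is why the dimension is that of the set of square
  roots.\<close>

lemma bhattacharyya_le_exp:
  assumes "x \<in> X" "x' \<in> X"
  shows "bhattacharyya x x' \<le> exp (- (\<Sum>y\<in>UNIV. (sqrt (p x y) - sqrt (p x' y))\<^sup>2) / 2)"
proof -
  have "(\<Sum>y\<in>UNIV. (sqrt (p x y) - sqrt (p x' y))\<^sup>2) = (\<Sum>y\<in>UNIV. p x y + p x' y - 2 * sqrt (p x y * p x' y))"
    using assms by (intro sum.cong refl) (simp add: power2_diff p_nonneg real_sqrt_mult)
  also have "\<dots> = 2 - 2 * bhattacharyya x x'"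
    using assms by (simp add: sum_subtractf sum.distrib p_sum bhattacharyya_def sum_distrib_left)
  finally have "bhattacharyya x x' = 1 + - (\<Sum>y\<in>UNIV. (sqrt (p x y) - sqrt (p x' y))\<^sup>2) / 2" by (simp add: field_simps)
  then show ?thesis by (metis exp_ge_add_one_self)
qed

lemma bhattacharyya_nonneg: "x \<in> X \<Longrightarrow> x' \<in> X \<Longrightarrow> 0 \<le> bhattacharyya x x'"
  unfolding bhattacharyya_def using p_nonneg by (intro sum_nonneg) auto

lemma bhattacharyya_word_le:
  assumes "length u = length v" "set u \<subseteq> A" "set v \<subseteq> A" and A: "A \<subseteq> X"
    and sep: "\<And>x x'. x \<in> A \<Longrightarrow> x' \<in> A \<Longrightarrow> x \<noteq> x' \<Longrightarrow> D \<le> (\<Sum>y\<in>UNIV. (sqrt (p x y) - sqrt (p x' y))\<^sup>2)"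
  shows "(\<Prod>(x, x')\<leftarrow>zip u v. bhattacharyya x x') \<le> exp (- D / 2 * real (hamming u v))"
  using assms(1-3)
proof (induction u v rule: list_induct2)
  case (Cons x u x' v)
  then have x: "x \<in> A" "x' \<in> A" "x \<in> X" "x' \<in> X" using A by auto
  have "bhattacharyya x x' \<le> exp (- D / 2 * of_bool (x \<noteq> x'))"
  proof -
    have "- (\<Sum>y\<in>UNIV. (sqrt (p x y) - sqrt (p x' y))\<^sup>2) / 2 \<le> - D / 2 * of_bool (x \<noteq> x')"
      using sep[OF x(1,2)] by (cases "x = x'") auto
    then show ?thesis using bhattacharyya_le_exp[OF x(3,4)] by (meson exp_le_cancel_iff order_trans)
  qed
  then have "bhattacharyya x x' * (\<Prod>(x, x')\<leftarrow>zip u v. bhattacharyya x x') \<le> exp (- D / 2 * of_bool (x \<noteq> x')) * exp (- D / 2 * real (hamming u v))"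
  proof (rule mult_mono)
    show "(\<Prod>(x, x')\<leftarrow>zip u v. bhattacharyya x x') \<le> exp (- D / 2 * real (hamming u v))" using Cons by auto
    show "0 \<le> (\<Prod>(x, x')\<leftarrow>zip u v. bhattacharyya x x')"
      using Cons.prems A
      by (intro prod_list_nonneg) (fastforce dest: set_zip_leftD set_zip_rightD intro!: bhattacharyya_nonneg)
  qed simp
  also have "\<dots> = exp (- D / 2 * real (hamming (x # u) (x' # v)))"
    by (simp add: algebra_simps flip: exp_add)
  finally show ?case by simp
qed simp

text \<open>On the intersection of the two typical sets both word probabilities are known up to a factor
  \<open>exp a\<close>, so there \<open>word_prob v\<close> is dominated by the geometric mean of \<open>word_prob u\<close> and \<open>word_prob v\<close>.\<close>

lemma typical_set_cross_prob:
  assumes l: "length u = length v" and u: "set u \<subseteq> X" and v: "set v \<subseteq> X" and a: "0 < a"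
    and H: "word_entropy u - word_entropy v \<le> 1"
  shows "(\<Sum>ys\<in>typical_set a u. word_prob v ys) \<le> 4 * CARD('y) * real (length v) / a\<^sup>2
      + exp (1/2 + a) * (\<Prod>(x, x')\<leftarrow>zip u v. bhattacharyya x x')"
proof -
  let ?S = "words (UNIV :: 'y set) (length u)"
  have fin: "finite ?S" by (rule finite_words) simp
  have sub: "typical_set a u \<subseteq> ?S" "typical_set a v \<subseteq> ?S" using l by (auto simp: typical_set_def)
  \<comment> \<open>Outputs atypical for \<open>v\<close> are bounded by Chebyshev; only the
    intersection needs the fidelity.\<close>
  have "(\<Sum>ys\<in>typical_set a u. word_prob v ys) = (\<Sum>ys\<in>typical_set a u - typical_set a v. word_prob v ys) + (\<Sum>ys\<in>typical_set a u \<inter> typical_set a v. word_prob v ys)"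
    using sub fin finite_subset by (metis add.commute sum.Int_Diff)
  also have "(\<Sum>ys\<in>typical_set a u - typical_set a v. word_prob v ys) \<le> (\<Sum>ys\<in>?S - typical_set a v. word_prob v ys)"
    using fin sub word_prob_nonneg[OF v] by (intro sum_mono2) auto
  also have "(\<Sum>ys\<in>?S - typical_set a v. word_prob v ys) \<le> 4 * CARD('y) * real (length v) / a\<^sup>2"
    using typical_set_prob[OF v a] sum.subset_diff[OF sub(2) fin, of "word_prob v"] word_prob_sum[OF v] l by simp
  also have "(\<Sum>ys\<in>typical_set a u \<inter> typical_set a v. word_prob v ys) \<le> (\<Sum>ys\<in>typical_set a u \<inter> typical_set a v. exp (1/2 + a) * sqrt (word_prob u ys * word_prob v ys))"
  proof (intro sum_mono)
    fix ys assume ys: "ys \<in> typical_set a u \<inter> typical_set a v"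
    then have pos: "0 < word_prob u ys" "0 < word_prob v ys" and d: "\<bar>entropy_dev u ys\<bar> < a" "\<bar>entropy_dev v ys\<bar> < a"
      and ly: "length u = length ys" "length v = length ys"
      using l by (auto simp: typical_set_def)
    \<comment> \<open>The ratio of the two probabilities is the exponential of an entropy
      difference, at most 1, plus a difference of deviations, at most \<open>2 * a\<close>. The root
      of \<open>exp (1 + 2 * a)\<close> is the factor in the claim.\<close>
    have "word_prob v ys = exp (2 * (1/2 + a) + (word_entropy u - word_entropy v - 1 + (entropy_dev u ys - a) - (entropy_dev v ys + a))) * word_prob u ys"
      unfolding word_prob_eq_exp[OF u ly(1) pos(1)] word_prob_eq_exp[OF v ly(2) pos(2)] exp_add[symmetric]
      by (simp add: algebra_simps)
    also have "\<dots> \<le> exp (2 * (1/2 + a)) * word_prob u ys"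
      using H d pos by (intro mult_right_mono) auto
    finally have "word_prob v ys * word_prob v ys \<le> (exp (1/2 + a))\<^sup>2 * (word_prob u ys * word_prob v ys)"
      using pos unfolding exp_double by (simp add: power2_eq_square mult_ac)
    then have "sqrt (word_prob v ys * word_prob v ys) \<le> sqrt ((exp (1/2 + a))\<^sup>2 * (word_prob u ys * word_prob v ys))"
      by (rule real_sqrt_le_mono)
    then show "word_prob v ys \<le> exp (1/2 + a) * sqrt (word_prob u ys * word_prob v ys)"
      using pos by (simp add: real_sqrt_mult)
  qed
  also have "\<dots> \<le> (\<Sum>ys\<in>?S. exp (1/2 + a) * sqrt (word_prob u ys * word_prob v ys))"
    using fin sub word_prob_nonneg[OF v] word_prob_nonneg[OF u] by (intro sum_mono2) auto
  also have "\<dots> = exp (1/2 + a) * (\<Prod>(x, x')\<leftarrow>zip u v. bhattacharyya x x')"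
    unfolding sum_distrib_left[symmetric] bhattacharyya_word[OF l u v] ..
  finally show ?thesis by simp
qed

text \<open>Two selections are paid for in the cardinality bound: equal integer parts of the entropy
  cost the factor \<open>n * CARD('y) + 1\<close>, and relative Hamming distance \<open>t\<close>
  costs the volume of a ball. Differing positions each contribute \<open>D / 2\<close> to the
  exponent of the fidelity.\<close>

lemma code_exists:
  assumes A: "finite A" "A \<noteq> {}" "A \<subseteq> X" and t: "0 < t" and a: "0 < a" and D: "0 \<le> D"
    and sep: "\<forall>x\<in>A. \<forall>x'\<in>A. x \<noteq> x' \<longrightarrow> D \<le> (\<Sum>y\<in>UNIV. (sqrt (p x y) - sqrt (p x' y))\<^sup>2)"
  shows "\<exists>C \<subseteq> words A n. 
      real (card A) ^ n \<le> (real n * CARD('y) + 1) * (real (card C) * (2 ^ n * real (card A) powr (t * real n)))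
    \<and> (\<forall>u\<in>C. 1 - 4 * CARD('y) * real n / a\<^sup>2 \<le> (\<Sum>ys\<in>typical_set a u. word_prob u ys))
    \<and> (\<forall>u\<in>C. \<forall>v\<in>C. u \<noteq> v \<longrightarrow> (\<Sum>ys\<in>typical_set a u. word_prob v ys)
         \<le> 4 * CARD('y) * real n / a\<^sup>2 + exp (1/2 + a - D / 2 * t * real n))"
proof -
  let ?S = "words A n"
  have fin: "finite ?S" using A by (simp add: finite_words)
  have X: "set u \<subseteq> X" if "u \<in> ?S" for u using that A by auto
  have "nat \<lfloor>word_entropy u\<rfloor> \<le> n * CARD('y)" if "u \<in> ?S" for u
  proof -
    have "word_entropy u \<le> real (n * CARD('y))" using word_entropy_bounds(2)[OF X[OF that]] that by simp
    then show ?thesis by (simp add: nat_le_iff floor_le_iff)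
  qed
  from large_fibre_exists[of ?S "\<lambda>u. nat \<lfloor>word_entropy u\<rfloor>", OF fin this] obtain k where
    k: "card ?S \<le> (n * CARD('y) + 1) * card {u \<in> ?S. nat \<lfloor>word_entropy u\<rfloor> = k}" by blast
  define S' where "S' = {u \<in> ?S. nat \<lfloor>word_entropy u\<rfloor> = k}"
  have S': "S' \<subseteq> ?S" by (auto simp: S'_def)
  with fin have S': "finite S'" "S' \<subseteq> ?S" by (simp_all add: finite_subset)
  have close: "word_entropy u - word_entropy v \<le> 1" if "u \<in> S'" "v \<in> S'" for u v
  proof -
    have "0 \<le> word_entropy u" "0 \<le> word_entropy v" using that S' X word_entropy_bounds(1) by blast+
    then have "0 \<le> \<lfloor>word_entropy u\<rfloor>" "0 \<le> \<lfloor>word_entropy v\<rfloor>" by simp_all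
    then have "\<lfloor>word_entropy u\<rfloor> = int k" "\<lfloor>word_entropy v\<rfloor> = int k"
      using that unfolding S'_def by (metis (mono_tags, lifting) mem_Collect_eq nat_0_le)+
    then show ?thesis by linarith
  qed
  show ?thesis
  proof (cases "n = 0")
    \<comment> \<open>For \<open>n = 0\<close> a word is not within distance strictly less than
      \<open>t * n\<close> of itself, so the greedy selection does not apply; the empty word alone
      is a code.\<close>
    case True
    let ?C = "{[]} :: 'x list set"
    have t0: "typical_set a [] = {[]}" using a by (auto simp: typical_set_def)
    have "0 < card A" using A by (simp add: card_gt_0_iff)
    then show ?thesis using True a by (intro exI[of _ ?C]) (simp add: t0)
  next
    case False
    have "\<exists>C\<subseteq>S'. (\<forall>x\<in>C. \<forall>y\<in>C. x \<noteq> y \<longrightarrow> \<not> real (hamming x y) < t * real n)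
         \<and> real (card S') \<le> real (card C) * (2 ^ n * real (card A) powr (t * real n))"
    proof (rule separated_subset_exists[OF S'(1)])
      fix u assume u: "u \<in> S'"
      show "real (hamming u u) < t * real n" using t False by simp
      have "card {v \<in> S'. real (hamming u v) < t * real n} \<le> card {v \<in> ?S. real (hamming u v) < t * real n}"
        by (rule card_mono[OF finite_subset[OF _ fin]]) (use S' in auto)
      also have "real \<dots> \<le> 2 ^ n * real (card A) powr (t * real n)"
        using u S' A t by (intro hamming_ball_card_le) auto
      finally show "real (card {v \<in> S'. real (hamming u v) < t * real n}) \<le> 2 ^ n * real (card A) powr (t * real n)"
        by simp
    qed (simp add: hamming_commute)
    then obtain C where C: "C \<subseteq> S'" "\<And>x y. x \<in> C \<Longrightarrow> y \<in> C \<Longrightarrow> x \<noteq> y \<Longrightarrow> t * real n \<le> real (hamming x y)"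
      and card: "real (card S') \<le> real (card C) * (2 ^ n * real (card A) powr (t * real n))"
      by (fastforce simp: not_less)
    have CS: "C \<subseteq> ?S" using C S' by blast
    have "real (card A) ^ n = real (card ?S)" using A by (simp add: card_lists_length_eq)
    also have "\<dots> \<le> real ((n * CARD('y) + 1) * card S')" using k unfolding S'_def by (simp only: of_nat_le_iff)
    also have "\<dots> = (real n * CARD('y) + 1) * real (card S')" by (simp add: algebra_simps)
    also have "\<dots> \<le> (real n * CARD('y) + 1) * (real (card C) * (2 ^ n * real (card A) powr (t * real n)))"
      by (intro mult_left_mono card) simp
    finally have 1: "real (card A) ^ n \<le> \<dots>" .
    have 2: "1 - 4 * CARD('y) * real n / a\<^sup>2 \<le> (\<Sum>ys\<in>typical_set a u. word_prob u ys)" if "u \<in> C" for u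
      using typical_set_prob[OF X a, of u] CS that by auto
    have 3: "(\<Sum>ys\<in>typical_set a u. word_prob v ys) \<le> 4 * CARD('y) * real n / a\<^sup>2 + exp (1/2 + a - D / 2 * t * real n)"
      if "u \<in> C" "v \<in> C" "u \<noteq> v" for u v
    proof -
      have uv: "length u = length v" "set u \<subseteq> A" "set v \<subseteq> A" "set u \<subseteq> X" "set v \<subseteq> X" "length v = n"
        using that CS X[of u] X[of v] by auto
      have "(\<Sum>ys\<in>typical_set a u. word_prob v ys) \<le> 4 * CARD('y) * real n / a\<^sup>2 + exp (1/2 + a) * (\<Prod>(x, x')\<leftarrow>zip u v. bhattacharyya x x')"
        using typical_set_cross_prob[OF uv(1,4,5) a close] that C uv(6) by auto
      moreover have "(\<Prod>(x, x')\<leftarrow>zip u v. bhattacharyya x x') \<le> exp (- D / 2 * real (hamming u v))"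
        by (rule bhattacharyya_word_le[OF uv(1-3) A(3)]) (use sep in blast)
      moreover have "exp (- D / 2 * real (hamming u v)) \<le> exp (- D / 2 * (t * real n))"
        using D C(2)[OF that] by (simp add: mult_left_mono)
      ultimately have "(\<Sum>ys\<in>typical_set a u. word_prob v ys)
          \<le> 4 * CARD('y) * real n / a\<^sup>2 + exp (1/2 + a) * exp (- D / 2 * (t * real n))"
        by (smt (verit) exp_ge_zero mult_left_mono)
      then show ?thesis unfolding exp_add[symmetric] by (simp add: algebra_simps)
    qed
    show ?thesis using CS 1 2 3 by blast
  qed
qed

end

section \<open>Simultaneous codes and the converse\<close>

definition output_prob :: "('x \<Rightarrow> complex mat) \<Rightarrow> ('y \<Rightarrow> complex mat) \<Rightarrow> 'x \<Rightarrow> 'y \<Rightarrow> real" where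
  "output_prob W T x y = Re (mtrace (W x * T y))"

locale cq_measured =
  fixes d :: nat and X :: "'x measure" and W :: "'x \<Rightarrow> complex mat" and T :: "'y::finite \<Rightarrow> complex mat"
  assumes cq: "cq_channel d X W" and T: "povm d UNIV T"
begin

lemma W_psd: "x \<in> space X \<Longrightarrow> psd d (W x)"
  using cq by (auto simp: cq_channel_def density_def)

lemma T_psd: "psd d (T y)"
  using T by (auto simp: povm_def)

lemma mtrace_output_prob: "x \<in> space X \<Longrightarrow> mtrace (W x * T y) = of_real (output_prob W T x y)"
  using psd_mult_trace_nonneg[OF W_psd T_psd, of x y]
  by (simp add: output_prob_def less_eq_complex_def complex_eq_iff)

sublocale dmc "space X" "output_prob W T"
proof
  fix x assume x: "x \<in> space X"
  show "0 \<le> output_prob W T x y" for y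
    using psd_mult_trace_nonneg[OF W_psd[OF x] T_psd, of y] by (simp add: output_prob_def less_eq_complex_def)
  have c: "W x \<in> carrier_mat d d" using W_psd[OF x] by (rule psd_carrier)
  have "(\<Sum>y\<in>UNIV. mtrace (W x * T y)) = mtrace (W x * msum d T UNIV)"
    using mtrace_mult_msum[OF c, of UNIV T] psd_carrier[OF T_psd] by simp
  also have "\<dots> = 1" using T cq x c by (simp add: povm_def cq_channel_def density_def)
  finally have "Re (\<Sum>y\<in>UNIV. mtrace (W x * T y)) = 1" by simp
  then show "(\<Sum>y\<in>UNIV. output_prob W T x y) = 1" by (simp add: output_prob_def)
qed

lemma word_prob_eq_trace:
  assumes "length u = length ys" "set u \<subseteq> space X"
  shows "Re (mtrace (tensor_word W u * tensor_word T ys)) = word_prob u ys"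
proof -
  have "mtrace (tensor_word W u * tensor_word T ys) = (\<Prod>(x, y)\<leftarrow>zip u ys. mtrace (W x * T y))"
    using assms by (intro mtrace_tensor_word_mult[where d = d]) (auto intro: psd_carrier W_psd T_psd)
  also have "\<dots> = of_real (word_prob u ys)"
    using assms by (induction u ys rule: list_induct2) (auto simp: mtrace_output_prob)
  finally show ?thesis by simp
qed

text \<open>All decoders are sums of elements of the same product measurement, so arbitrary
  acceptance sets \<open>Z u\<close>, overlapping or not, give a simultaneous code.\<close>

lemma simultaneous_code:
  assumes C: "C \<subseteq> words (space X) n" "finite C" and Z: "\<And>u. u \<in> C \<Longrightarrow> Z u \<subseteq> words UNIV n"
    and e1: "\<And>u. u \<in> C \<Longrightarrow> 1 - l1 \<le> (\<Sum>ys\<in>Z u. word_prob u ys)"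
    and e2: "\<And>u v. u \<in> C \<Longrightarrow> v \<in> C \<Longrightarrow> u \<noteq> v \<Longrightarrow> (\<Sum>ys\<in>Z u. word_prob v ys) \<le> l2"
  shows "ereal (real (card C)) \<le> N_DI_sim d X W n l1 l2"
proof -
  let ?S = "words (UNIV :: 'y set) n"
  have "finite ?S" by (rule finite_words) simp
  \<comment> \<open>Output words are enumerated because \<open>simultaneous\<close> labels
    measurement outcomes by natural numbers.\<close>
  then obtain f where f: "bij_betw f {0..<card ?S} ?S" using ex_bij_betw_nat_finite by blast
  obtain c where c: "bij_betw c {0..<card C} C" using ex_bij_betw_nat_finite[OF C(2)] by blast
  define Mo where "Mo = {0..<card ?S}"
  define D where "D m = tensor_word T (f m)" for m
  define Ms where "Ms j = {m \<in> Mo. f m \<in> Z (c j)}" for j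
  define E where "E j = msum (d ^ n) D (Ms j)" for j
  have fS: "f m \<in> ?S" if "m \<in> Mo" for m using f that by (auto simp: Mo_def bij_betw_def)
  have cC: "c j \<in> C" if "j < card C" for j using c that by (auto simp: bij_betw_def)
  have Dpsd: "psd (d ^ n) (D m)" if "m \<in> Mo" for m
    using psd_tensor_word[of "f m" d T] T_psd fS[OF that] by (simp add: D_def)
  have povm: "povm (d ^ n) Mo D"
    unfolding povm_def
  proof (intro conjI ballI Dpsd)
    have "msum (d ^ n) D Mo = msum (d ^ n) (tensor_word T) ?S"
    proof -
      have "(\<Sum>m\<in>Mo. tensor_word T (f m) $$ ij) = (\<Sum>ys\<in>?S. tensor_word T ys $$ ij)" for ij
        unfolding Mo_def by (rule sum.reindex_bij_betw[OF f])
      then show ?thesis unfolding msum_def D_def by simp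
    qed
    then show "msum (d ^ n) D Mo = 1\<^sub>m (d ^ n)"
      using msum_tensor_word[of UNIV T d n] T psd_carrier[OF T_psd] by (simp add: povm_def)
  qed (simp_all add: Mo_def)
  have Ms: "Ms j \<subseteq> Mo" for j by (auto simp: Ms_def)
  have tr: "Re (mtrace (tensor_word W u * E j)) = (\<Sum>ys\<in>Z (c j). word_prob u ys)"
    if "u \<in> words (space X) n" "j < card C" for u j
  proof -
    have "tensor_word W u \<in> carrier_mat (d ^ n) (d ^ n)"
      using tensor_word_carrier[of u W d] psd_carrier W_psd that by blast
    then have "mtrace (tensor_word W u * E j) = (\<Sum>m\<in>Ms j. mtrace (tensor_word W u * D m))"
      unfolding E_def using Ms Dpsd psd_carrier by (intro mtrace_mult_msum) blast+
    then have "Re (mtrace (tensor_word W u * E j)) = (\<Sum>m\<in>Ms j. word_prob u (f m))"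
      using word_prob_eq_trace that fS Ms by (simp add: D_def) (intro sum.cong refl, force)
    also have "\<dots> = (\<Sum>ys\<in>Z (c j). word_prob u ys)"
    proof (rule sum.reindex_bij_betw)
      have "f ` Ms j = Z (c j)"
      proof -
        have "f ` Mo = ?S" using f by (simp add: bij_betw_def Mo_def)
        then have "Z (c j) \<subseteq> f ` Mo" using Z[OF cC[OF that(2)]] by simp
        then show ?thesis unfolding Ms_def by blast
      qed
      then show "bij_betw f (Ms j) (Z (c j))"
        using f Ms unfolding bij_betw_def Mo_def by (meson inj_on_subset)
    qed
    finally show ?thesis .
  qed
  have "DI_code d X W n (card C) l1 l2 c E"
    unfolding DI_code_def
  proof (intro conjI allI impI)
    fix j assume j: "j < card C"
    have cj: "c j \<in> words (space X) n" using cC[OF j] C by blast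
    show "c j \<in> lists (space X)" "length (c j) = n" using cj by auto
    show "effect (d ^ n) (E j)" unfolding E_def by (rule povm_effect[OF povm Ms])
    show "1 - l1 \<le> Re (mtrace (tensor_word W (c j) * E j))"
      unfolding tr[OF cj j] by (rule e1[OF cC[OF j]])
    fix k assume k: "k < card C" "j \<noteq> k"
    have "c j \<noteq> c k" using c j k by (auto simp: bij_betw_def inj_on_def)
    then show "Re (mtrace (tensor_word W (c j) * E k)) \<le> l2"
      unfolding tr[OF cj k(1)] using e2[OF cC[OF k(1)] cC[OF j]] by auto
  qed
  moreover have "simultaneous d n (card C) E"
    unfolding simultaneous_def using povm Ms by (auto simp: E_def intro!: exI[of _ Mo] exI[of _ D] exI[of _ Ms])
  ultimately show ?thesis
    unfolding N_DI_sim_def by (intro SUP_upper) blast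
qed

end

section \<open>Traces against an effect as quadratic forms on the columns of a root\<close>

lemma hermitian_mat_trace_form:
  assumes M: "hermitian_mat n M" and E: "E \<in> carrier_mat n n"
  shows "mtrace (M * M * E) = (\<Sum>j<n. inner_vec n (\<lambda>i. M $$ (i, j)) (apply_mat n E (\<lambda>i. M $$ (i, j))))"
proof -
  note c = hermitian_mat_carrier[OF M]
  have "mtrace (M * M * E) = mtrace (M * (E * M))"
    using mtrace_comm[OF c mult_carrier_mat[OF c E]] assoc_mult_mat[OF c c E] assoc_mult_mat[OF c E c] by simp
  also have "\<dots> = (\<Sum>j<n. \<Sum>i<n. \<Sum>k<n. M $$ (j, i) * (E $$ (i, k) * M $$ (k, j)))"
    using c E by (simp add: mtrace_def index_mult_mat_sum[OF c mult_carrier_mat[OF E c]]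
        index_mult_mat_sum[OF E c] sum_distrib_left del: index_mult_mat(1))
  also have "\<dots> = (\<Sum>j<n. inner_vec n (\<lambda>i. M $$ (i, j)) (apply_mat n E (\<lambda>i. M $$ (i, j))))"
    unfolding inner_vec_apply_mat
  proof (intro sum.cong refl)
    fix i j k assume "i \<in> {..<n}" "j \<in> {..<n}"
    then have "M $$ (j, i) = cnj (M $$ (i, j))" using M unfolding hermitian_mat_def by blast
    then show "M $$ (j, i) * (E $$ (i, k) * M $$ (k, j)) = cnj (M $$ (i, j)) * E $$ (i, k) * M $$ (k, j)"
      by (simp add: mult.assoc)
  qed
  finally show ?thesis .
qed

lemma hermitian_mat_trace_square:
  assumes M: "hermitian_mat n M"
  shows "Re (mtrace (M * M)) = (\<Sum>j<n. \<Sum>i<n. (cmod (M $$ (i, j)))\<^sup>2)"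
  using hermitian_mat_trace_form[OF M one_carrier_mat] right_mult_one_mat[OF mult_carrier_mat[OF hermitian_mat_carrier[OF M] hermitian_mat_carrier[OF M]]]
  by (simp add: inner_vec_apply_mat_one inner_vec_self)

text \<open>Young's inequality for the cross term, from positivity at \<open>r * u - v / r\<close>.
  A small \<open>s\<close> keeps the first coefficient near 1; an unweighted bound would double the
  error of the second kind.\<close>

lemma psd_form_add_le:
  assumes E: "psd n E" and s: "0 < s"
  shows "Re (inner_vec n (\<lambda>i. u i + v i) (apply_mat n E (\<lambda>i. u i + v i)))
     \<le> (1 + s) * Re (inner_vec n u (apply_mat n E u)) + (1 + 1 / s) * Re (inner_vec n v (apply_mat n E v))"
proof -
  define r where "r = sqrt s"
  have r: "0 < r" "s = r * r" using s by (simp_all add: r_def)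
  have "0 \<le> r * r * Re (inner_vec n u (apply_mat n E u)) - (Re (inner_vec n u (apply_mat n E v)) + Re (inner_vec n v (apply_mat n E u)))
      + 1 / r * (1 / r) * Re (inner_vec n v (apply_mat n E v))"
    using psd_form_expand[OF E, of "of_real r" u "- of_real (1 / r)" v] r
    by (simp add: less_eq_complex_def)
  moreover have "inner_vec n (\<lambda>i. u i + v i) (apply_mat n E (\<lambda>i. u i + v i))
      = inner_vec n u (apply_mat n E u) + inner_vec n u (apply_mat n E v) + inner_vec n v (apply_mat n E u) + inner_vec n v (apply_mat n E v)"
    using apply_mat_lin[of n E 1 u 1 v] inner_vec_lin_left[of n 1 u 1 v] inner_vec_lin_right[of n _ 1 "apply_mat n E u" 1 "apply_mat n E v"]
    by simp
  ultimately show ?thesis unfolding r(2) using r(1) by (simp add: algebra_simps)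
qed

lemma hermitian_mat_minus:
  assumes "hermitian_mat n A" "hermitian_mat n B"
  shows "hermitian_mat n (A - B)"
  unfolding hermitian_mat_def
proof (intro conjI allI impI)
  note c = hermitian_mat_carrier[OF assms(2)]
  show "A - B \<in> carrier_mat n n" using c by (rule minus_carrier_mat)
  fix i j assume ij: "i < n" "j < n"
  with assms have "A $$ (j, i) = cnj (A $$ (i, j))" "B $$ (j, i) = cnj (B $$ (i, j))"
    unfolding hermitian_mat_def by blast+
  then show "(A - B) $$ (j, i) = cnj ((A - B) $$ (i, j))" using ij c by simp
qed

text \<open>The previous inequality summed over columns. The third matrix serves two uses:
  \<open>C = 0\<close> compares two codewords under a decoder, and \<open>E = 1\<close> gives a
  squared triangle inequality in the Hilbert-Schmidt norm.\<close>

lemma trace_form_diff_le: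
  assumes A: "hermitian_mat n A" and B: "hermitian_mat n B" and C: "hermitian_mat n C" and E: "psd n E" and s: "0 < s"
  shows "Re (mtrace ((A - C) * (A - C) * E))
     \<le> (1 + s) * Re (mtrace ((B - C) * (B - C) * E)) + (1 + 1 / s) * Re (mtrace ((A - B) * (A - B) * E))"
proof -
  note cE = psd_carrier[OF E] and c = hermitian_mat_carrier[OF A] hermitian_mat_carrier[OF B] hermitian_mat_carrier[OF C]
  define f g where "f j = (\<lambda>i. (B - C) $$ (i, j))" and "g j = (\<lambda>i. (A - B) $$ (i, j))" for j
  let ?q = "\<lambda>u. Re (inner_vec n u (apply_mat n E u))"
  have h: "?q (\<lambda>i. (A - C) $$ (i, j)) = ?q (\<lambda>i. f j i + g j i)" if "j < n" for j
    using that c by (simp add: inner_vec_apply_mat f_def g_def)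
  have "Re (mtrace ((A - C) * (A - C) * E)) = (\<Sum>j<n. ?q (\<lambda>i. f j i + g j i))"
    unfolding hermitian_mat_trace_form[OF hermitian_mat_minus[OF A C] cE] by (simp add: h)
  also have "\<dots> \<le> (\<Sum>j<n. (1 + s) * ?q (f j) + (1 + 1 / s) * ?q (g j))"
    by (intro sum_mono psd_form_add_le E s)
  also have "\<dots> = (1 + s) * Re (mtrace ((B - C) * (B - C) * E)) + (1 + 1 / s) * Re (mtrace ((A - B) * (A - B) * E))"
    unfolding hermitian_mat_trace_form[OF hermitian_mat_minus[OF B C] cE] hermitian_mat_trace_form[OF hermitian_mat_minus[OF A B] cE]
    by (simp add: sum.distrib sum_distrib_left f_def g_def)
  finally show ?thesis .
qed

lemma trace_effect_le:
  assumes M: "hermitian_mat n M" and E: "effect n E"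
  shows "Re (mtrace (M * M * E)) \<le> Re (mtrace (M * M))"
proof -
  have cE: "E \<in> carrier_mat n n" using E psd_carrier by (auto simp: effect_def)
  have "Re (mtrace (M * M * E)) \<le> (\<Sum>j<n. Re (inner_vec n (\<lambda>i. M $$ (i, j)) (\<lambda>i. M $$ (i, j))))"
    using E unfolding hermitian_mat_trace_form[OF M cE] Re_sum effect_iff less_eq_complex_def by (intro sum_mono) blast
  then show ?thesis by (simp add: hermitian_mat_trace_square[OF M] inner_vec_self)
qed

lemma hermitian_mat_zero: "hermitian_mat n (0\<^sub>m n n)"
  by (simp add: hermitian_mat_def)

lemma mtrace_square_diff:
  assumes A: "A \<in> carrier_mat n n" and B: "B \<in> carrier_mat n n"
  shows "mtrace ((A - B) * (A - B)) = mtrace (A * A) + mtrace (B * B) - 2 * mtrace (A * B)"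
proof -
  have m: "mtrace (P - Q) = mtrace P - mtrace Q" if "P \<in> carrier_mat n n" "Q \<in> carrier_mat n n" for P Q
    using that by (simp add: mtrace_def sum_subtractf)
  note c = mult_carrier_mat[OF A A] mult_carrier_mat[OF A B] mult_carrier_mat[OF B A] mult_carrier_mat[OF B B]
  have "(A - B) * (A - B) = (A * A - A * B) - (B * A - B * B)"
    unfolding minus_mult_distrib_mat[OF A B minus_carrier_mat[OF B]]
      mult_minus_distrib_mat[OF A A B] mult_minus_distrib_mat[OF B A B] ..
  then show ?thesis
    using mtrace_comm[OF A B] by (simp add: m c minus_carrier_mat[OF c(2)] minus_carrier_mat[OF c(4)])
qed

lemma sqrt_tensor_word:
  assumes "\<And>x. x \<in> set u \<Longrightarrow> psd d (W x)"
  shows "tensor_word (\<lambda>x. mat_sqrt d (W x)) u * tensor_word (\<lambda>x. mat_sqrt d (W x)) u = tensor_word W u"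
proof -
  have "tensor_word (\<lambda>(x, y). mat_sqrt d (W x) * mat_sqrt d (W y)) (zip u u) = tensor_word W u"
    using assms by (induction u) (auto simp: mat_sqrt(2))
  moreover have "tensor_word (\<lambda>x. mat_sqrt d (W x)) u * tensor_word (\<lambda>x. mat_sqrt d (W x)) u
      = tensor_word (\<lambda>(x, y). mat_sqrt d (W x) * mat_sqrt d (W y)) (zip u u)"
    using assms by (intro tensor_word_mult[where d = d]) (auto intro!: psd_carrier mat_sqrt(1))
  ultimately show ?thesis by simp
qed

text \<open>\<open>Tr W\<^sub>u E\<close> is the quadratic form of \<open>E\<close> at the Hilbert-Schmidt vector \<open>\<surd>W\<^sub>u\<close>,
  so codewords with close square roots cannot be distinguished by \<open>E\<close>.\<close>

lemma tensor_word_trace_le: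
  assumes u: "\<And>x. x \<in> set u \<Longrightarrow> density d (W x)" and v: "\<And>x. x \<in> set v \<Longrightarrow> density d (W x)"
    and l: "length u = length v" and E: "effect (d ^ length u) E" and s: "0 < s"
  shows "Re (mtrace (tensor_word W u * E)) \<le> (1 + s) * Re (mtrace (tensor_word W v * E))
    + (1 + 1 / s) * (2 - 2 * (\<Prod>(x, y)\<leftarrow>zip u v. Re (mtrace (mat_sqrt d (W x) * mat_sqrt d (W y)))))"
proof -
  define m where "m = d ^ length u"
  let ?R = "\<lambda>x. mat_sqrt d (W x)"
  have pu: "psd d (?R x)" if "x \<in> set u" for x using u[OF that] mat_sqrt(1) by (simp add: density_def)
  have pv: "psd d (?R x)" if "x \<in> set v" for x using v[OF that] mat_sqrt(1) by (simp add: density_def)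
  define A B where "A = tensor_word ?R u" and "B = tensor_word ?R v"
  have A: "psd m A" unfolding A_def m_def by (rule psd_tensor_word[OF pu])
  have B: "psd m B" unfolding B_def m_def l by (rule psd_tensor_word[OF pv])
  note hA = psd_hermitian_mat[OF A] and hB = psd_hermitian_mat[OF B]
  have AA: "A * A = tensor_word W u" unfolding A_def using u by (intro sqrt_tensor_word) (simp add: density_def)
  have BB: "B * B = tensor_word W v" unfolding B_def using v by (intro sqrt_tensor_word) (simp add: density_def)
  have tr1: "mtrace (tensor_word W w) = 1" if "\<And>x. x \<in> set w \<Longrightarrow> density d (W x)" for w
  proof -
    have "mtrace (tensor_word W w) = (\<Prod>x\<leftarrow>w. mtrace (W x))"
      using that by (intro mtrace_tensor_word[where d = d]) (auto simp: density_def intro: psd_carrier)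
    also have "\<dots> = 1" using that by (induction w) (auto simp: density_def)
    finally show ?thesis .
  qed
  have "mtrace (A * B) = (\<Prod>(x, y)\<leftarrow>zip u v. mtrace (?R x * ?R y))"
    unfolding A_def B_def using l pu pv by (intro mtrace_tensor_word_mult[where d = d]) (auto intro: psd_carrier)
  \<comment> \<open>Each overlap is the trace of a product of positive matrices and hence real, so
    taking real parts commutes with the product.\<close>
  also have "\<dots> = of_real (\<Prod>(x, y)\<leftarrow>zip u v. Re (mtrace (?R x * ?R y)))"
    using l pu pv
  proof (induction u v rule: list_induct2)
    case (Cons x u y v)
    then have "0 \<le> mtrace (?R x * ?R y)" by (intro psd_mult_trace_nonneg) auto
    then have "mtrace (?R x * ?R y) = of_real (Re (mtrace (?R x * ?R y)))"
      by (simp add: less_eq_complex_def complex_eq_iff)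
    then show ?case using Cons by simp
  qed simp
  finally have AB: "Re (mtrace (A * B)) = (\<Prod>(x, y)\<leftarrow>zip u v. Re (mtrace (?R x * ?R y)))" by simp
  have z: "P - 0\<^sub>m m m = P" if "P \<in> carrier_mat m m" for P :: "complex mat"
    using that by (intro eq_matI) auto
  have E': "effect m E" "psd m E" using E by (simp_all add: m_def effect_def)
  note cA = psd_carrier[OF A] and cB = psd_carrier[OF B]
  have "Re (mtrace (A * A * E)) \<le> (1 + s) * Re (mtrace (B * B * E)) + (1 + 1 / s) * Re (mtrace ((A - B) * (A - B) * E))"
    using trace_form_diff_le[OF hA hB hermitian_mat_zero E'(2) s] unfolding z[OF cA] z[OF cB] .
  also have "Re (mtrace ((A - B) * (A - B) * E)) \<le> Re (mtrace ((A - B) * (A - B)))"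
    by (rule trace_effect_le[OF hermitian_mat_minus[OF hA hB] E'(1)])
  also have "Re (mtrace ((A - B) * (A - B))) = 2 - 2 * Re (mtrace (A * B))"
    unfolding mtrace_square_diff[OF cA cB] AA BB using tr1 u v by simp
  finally show ?thesis
    unfolding AA BB AB using s by (simp add: mult_left_mono)
qed

lemma hs_dist_square:
  assumes "hermitian_mat n M" "hermitian_mat n N"
  shows "(hs_dist M N)\<^sup>2 = Re (mtrace ((M - N) * (M - N)))" "0 \<le> hs_dist M N"
proof -
  have "0 \<le> Re (mtrace ((M - N) * (M - N)))"
    unfolding hermitian_mat_trace_square[OF hermitian_mat_minus[OF assms]] by (intro sum_nonneg) simp
  then show "(hs_dist M N)\<^sup>2 = Re (mtrace ((M - N) * (M - N)))" "0 \<le> hs_dist M N"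
    by (simp_all add: hs_dist_def)
qed

text \<open>Both roots lie within \<open>\<delta>\<close> of \<open>M\<close>, so their squared
  distance is at most \<open>4 * \<delta>\<^sup>2\<close>; for states it equals 2 minus twice the
  overlap.\<close>

lemma sqrt_overlap_ge:
  assumes \<rho>: "density d \<rho>" and \<sigma>: "density d \<sigma>" and M: "hermitian_mat d M"
    and 1: "hs_dist M (mat_sqrt d \<rho>) \<le> \<delta>" and 2: "hs_dist M (mat_sqrt d \<sigma>) \<le> \<delta>"
  shows "1 - 2 * \<delta>\<^sup>2 \<le> Re (mtrace (mat_sqrt d \<rho> * mat_sqrt d \<sigma>))"
proof -
  define A B where "A = mat_sqrt d \<rho>" and "B = mat_sqrt d \<sigma>"
  have A: "hermitian_mat d A" "A * A = \<rho>" and B: "hermitian_mat d B" "B * B = \<sigma>"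
    using \<rho> \<sigma> mat_sqrt psd_hermitian_mat unfolding A_def B_def density_def by blast+
  note cA = hermitian_mat_carrier[OF A(1)] and cB = hermitian_mat_carrier[OF B(1)] and cM = hermitian_mat_carrier[OF M]
  have one: "P * P * 1\<^sub>m d = P * P" if "hermitian_mat d P" for P
    using right_mult_one_mat[OF mult_carrier_mat[OF hermitian_mat_carrier[OF that] hermitian_mat_carrier[OF that]]] .
  have sq: "Re (mtrace ((P - Q) * (P - Q))) \<le> \<delta>\<^sup>2" if "hermitian_mat d P" "hermitian_mat d Q" "hs_dist P Q \<le> \<delta>" for P Q
    using power_mono[OF that(3) hs_dist_square(2)[OF that(1,2)], of 2] hs_dist_square(1)[OF that(1,2)] by simp
  have sym: "hs_dist A M = hs_dist M A"
    using mtrace_square_diff[OF cA cM] mtrace_square_diff[OF cM cA] mtrace_comm[OF cA cM]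
    by (simp add: hs_dist_def)
  have "Re (mtrace ((A - B) * (A - B))) \<le> 2 * Re (mtrace ((M - B) * (M - B))) + 2 * Re (mtrace ((A - M) * (A - M)))"
    using trace_form_diff_le[OF A(1) M B(1) psd_one, of 1]
    unfolding one[OF hermitian_mat_minus[OF A(1) B(1)]] one[OF hermitian_mat_minus[OF M B(1)]] one[OF hermitian_mat_minus[OF A(1) M]]
    by simp
  also have "\<dots> \<le> 4 * \<delta>\<^sup>2"
    using sq[OF M B(1)] sq[OF A(1) M] 1 2 sym unfolding A_def[symmetric] B_def[symmetric] by simp
  also have "Re (mtrace ((A - B) * (A - B))) = 2 - 2 * Re (mtrace (A * B))"
    unfolding mtrace_square_diff[OF cA cB] A(2) B(2) using \<rho> \<sigma> by (simp add: density_def)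
  finally show ?thesis unfolding A_def B_def by simp
qed

section \<open>Covers, packings and the size of a code\<close>

definition is_cover :: "('a \<Rightarrow> 'a \<Rightarrow> real) \<Rightarrow> 'a set \<Rightarrow> real \<Rightarrow> 'a set \<Rightarrow> bool" where
  "is_cover dst F \<delta> C \<longleftrightarrow> C \<subseteq> F \<and> finite C \<and> F \<subseteq> (\<Union>c\<in>C. {y. dst c y \<le> \<delta>})"

lemma covering_number_altdef: "covering_number dst F \<delta> = (LEAST k. \<exists>C. is_cover dst F \<delta> C \<and> card C = k)"
  unfolding covering_number_def is_cover_def by (intro arg_cong[of _ _ Least] ext) blast

text \<open>The minimum in \<open>covering_number\<close> is meaningful only once some finite cover
  is known to exist, hence the premise.\<close>

lemma optimal_cover_exists:
  assumes "is_cover dst F \<delta> C"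
  shows "\<exists>C. is_cover dst F \<delta> C \<and> card C = covering_number dst F \<delta>"
  unfolding covering_number_altdef by (rule LeastI_ex) (use assms in blast)

lemma covering_number_le: "is_cover dst F \<delta> C \<Longrightarrow> covering_number dst F \<delta> \<le> card C"
  unfolding covering_number_altdef by (rule Least_le) blast

text \<open>A set with fewer points than the covering number is not a cover, so it leaves a point at
  distance more than \<open>\<delta>\<close> from all its members, which can be added. This holds
  whether or not finite covers exist.\<close>

lemma packing_exists:
  assumes "m \<le> covering_number dst F \<delta>" and refl: "\<And>x. dst x x \<le> \<delta>"
    and sym: "\<And>x y. dst x y = dst y x"
  shows "\<exists>A\<subseteq>F. finite A \<and> card A = m \<and> (\<forall>x\<in>A. \<forall>y\<in>A. x \<noteq> y \<longrightarrow> \<delta> < dst x y)"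
  using assms(1)
proof (induction m)
  case (Suc m)
  then obtain A where A: "A \<subseteq> F" "finite A" "card A = m" "\<forall>x\<in>A. \<forall>y\<in>A. x \<noteq> y \<longrightarrow> \<delta> < dst x y"
    by force
  have "\<not> is_cover dst F \<delta> A" using covering_number_le[of dst F \<delta> A] A Suc.prems by auto
  then obtain y where y: "y \<in> F" "\<forall>c\<in>A. \<delta> < dst c y" using A unfolding is_cover_def by (force simp: not_le)
  show ?case
  proof (cases "y \<in> A")
    case False
    then show ?thesis using A y sym by (intro exI[of _ "insert y A"]) auto
  next
    case True
    then show ?thesis using y refl[of y] by (auto simp: not_le dest!: bspec[of _ _ y])
  qed
qed auto

text \<open>Entries are bounded by 1, so rounding their real and imaginary parts to a grid leaves
  finitely many cells.\<close>

lemma sqrt_cover_exists: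
  assumes F: "\<And>M. M \<in> F \<Longrightarrow> hermitian_mat d M \<and> Re (mtrace (M * M)) \<le> 1" and d: "0 < d" and \<delta>: "0 < \<delta>"
  shows "\<exists>C. is_cover hs_dist F \<delta> C"
proof -
  \<comment> \<open>Matrices in one cell differ by at most \<open>2 * \<eta>\<^sup>2\<close> in
    squared modulus at each of the \<open>d * d\<close> entries, in total at most
    \<open>\<delta>\<^sup>2 / 2\<close>.\<close>
  define \<eta> where "\<eta> = \<delta> / (2 * real d)"
  have \<eta>: "0 < \<eta>" using d \<delta> by (simp add: \<eta>_def)
  define code where "code M = (\<lambda>ij\<in>{..<d} \<times> {..<d}. (\<lfloor>Re (M $$ ij) / \<eta>\<rfloor>, \<lfloor>Im (M $$ ij) / \<eta>\<rfloor>))" for M :: "complex mat"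
  define L where "L = \<lceil>1 / \<eta>\<rceil>"
  have entry: "cmod (M $$ (i, j)) \<le> 1" if "M \<in> F" "i < d" "j < d" for M i j
  proof -
    have h: "hermitian_mat d M" using F that by blast
    have "(cmod (M $$ (i, j)))\<^sup>2 \<le> (\<Sum>i<d. (cmod (M $$ (i, j)))\<^sup>2)"
      using that by (intro member_le_sum) auto
    also have "\<dots> \<le> (\<Sum>j<d. \<Sum>i<d. (cmod (M $$ (i, j)))\<^sup>2)"
      using that by (intro member_le_sum[of j "{..<d}" "\<lambda>j. \<Sum>i<d. (cmod (M $$ (i, j)))\<^sup>2"]) (auto intro: sum_nonneg)
    also have "\<dots> \<le> 1" using F[OF that(1)] hermitian_mat_trace_square[OF h] by simp
    finally show ?thesis using power2_le_imp_le[of _ 1] by simp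
  qed
  have fl: "\<lfloor>r / \<eta>\<rfloor> \<in> {- L..L}" if "\<bar>r\<bar> \<le> 1" for r
  proof -
    have "r / \<eta> \<le> 1 / \<eta>" "- (1 / \<eta>) \<le> r / \<eta>" using that \<eta> by (simp_all add: field_simps)
    then show ?thesis unfolding L_def by (auto simp: ceiling_def) linarith+
  qed
  have "code ` F \<subseteq> (\<Pi>\<^sub>E ij\<in>{..<d} \<times> {..<d}. {- L..L} \<times> {- L..L})"
  proof
    fix c assume "c \<in> code ` F"
    then obtain M where M: "M \<in> F" "c = code M" by blast
    have "\<bar>Re (M $$ (i, j))\<bar> \<le> 1 \<and> \<bar>Im (M $$ (i, j))\<bar> \<le> 1" if "i < d" "j < d" for i j
      using entry[OF M(1) that] abs_Re_le_cmod abs_Im_le_cmod order_trans by blast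
    then show "c \<in> (\<Pi>\<^sub>E ij\<in>{..<d} \<times> {..<d}. {- L..L} \<times> {- L..L})"
      unfolding M(2) code_def using fl by (auto simp del: atLeastAtMost_iff)
  qed
  then have fin: "finite (code ` F)" by (rule finite_subset) (intro finite_PiE, auto)
  \<comment> \<open>Centres must belong to \<open>F\<close>, so each occupied cell is represented by
    one of its members, not by a grid point.\<close>
  define C where "C = inv_into F code ` (code ` F)"
  have "F \<subseteq> (\<Union>c\<in>C. {y. hs_dist c y \<le> \<delta>})"
  proof
    fix M assume M: "M \<in> F"
    define N where "N = inv_into F code (code M)"
    have N: "N \<in> F" "code N = code M" "N \<in> C"
      unfolding N_def C_def using M by (auto intro: inv_into_into f_inv_into_f)
    have h: "hermitian_mat d M" "hermitian_mat d N" using F M N by auto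
    have close: "\<bar>x - y\<bar> \<le> \<eta>" if "\<lfloor>x / \<eta>\<rfloor> = \<lfloor>y / \<eta>\<rfloor>" for x y
    proof -
      have "\<bar>x / \<eta> - y / \<eta>\<bar> < 1" using that by linarith
      then show ?thesis using \<eta> by (simp add: field_simps flip: diff_divide_distrib)
    qed
    have "(cmod ((N - M) $$ (i, j)))\<^sup>2 \<le> 2 * \<eta>\<^sup>2" if ij: "i < d" "j < d" for i j
    proof -
      have "\<lfloor>Re (N $$ (i, j)) / \<eta>\<rfloor> = \<lfloor>Re (M $$ (i, j)) / \<eta>\<rfloor>" "\<lfloor>Im (N $$ (i, j)) / \<eta>\<rfloor> = \<lfloor>Im (M $$ (i, j)) / \<eta>\<rfloor>"
        using fun_cong[OF N(2), of "(i, j)"] ij by (simp_all add: code_def)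
      then have "\<bar>Re (N $$ (i, j)) - Re (M $$ (i, j))\<bar> \<le> \<eta>" "\<bar>Im (N $$ (i, j)) - Im (M $$ (i, j))\<bar> \<le> \<eta>"
        by (auto intro: close)
      then have "(Re (N $$ (i, j)) - Re (M $$ (i, j)))\<^sup>2 \<le> \<eta>\<^sup>2" "(Im (N $$ (i, j)) - Im (M $$ (i, j)))\<^sup>2 \<le> \<eta>\<^sup>2"
        using \<eta> by (metis abs_ge_zero power2_abs power_mono)+
      then show ?thesis using ij hermitian_mat_carrier[OF h(1)] by (simp add: cmod_power2)
    qed
    then have "(\<Sum>j<d. \<Sum>i<d. (cmod ((N - M) $$ (i, j)))\<^sup>2) \<le> (\<Sum>j<d. \<Sum>i<d. 2 * \<eta>\<^sup>2)"
      by (intro sum_mono) auto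
    also have "\<dots> \<le> \<delta>\<^sup>2" using d by (simp add: \<eta>_def power2_eq_square field_simps)
    finally have "(hs_dist N M)\<^sup>2 \<le> \<delta>\<^sup>2"
      using hs_dist_square(1)[OF h(2,1)] hermitian_mat_trace_square[OF hermitian_mat_minus[OF h(2,1)]] by simp
    then have "hs_dist N M \<le> \<delta>" using \<delta> power2_le_imp_le by fastforce
    then show "M \<in> (\<Union>c\<in>C. {y. hs_dist c y \<le> \<delta>})" using N by blast
  qed
  moreover have "C \<subseteq> F" unfolding C_def by (auto intro: inv_into_into)
  ultimately show ?thesis using fin unfolding is_cover_def C_def by blast
qed

text \<open>The map \<open>c\<close> rounds letters to centres. The condition on
  \<open>\<delta>\<close> keeps the lower bounds of the factors nonnegative, so that they may be
  multiplied.\<close>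

lemma overlap_word_ge:
  assumes "length u = length v"
    and "\<And>x. x \<in> set u \<Longrightarrow> density d (W x) \<and> hermitian_mat d (c x) \<and> hs_dist (c x) (mat_sqrt d (W x)) \<le> \<delta>"
    and "\<And>x. x \<in> set v \<Longrightarrow> density d (W x) \<and> hs_dist (c x) (mat_sqrt d (W x)) \<le> \<delta>"
    and "map c u = map c v" and \<delta>: "2 * \<delta>\<^sup>2 \<le> 1"
  shows "(1 - 2 * \<delta>\<^sup>2) ^ length u \<le> (\<Prod>(x, y)\<leftarrow>zip u v. Re (mtrace (mat_sqrt d (W x) * mat_sqrt d (W y))))"
  using assms(1-4)
proof (induction u v rule: list_induct2)
  case (Cons x u y v)
  have "c x = c y" using Cons.prems by simp
  then have xy: "density d (W x)" "density d (W y)" "hermitian_mat d (c x)" "hs_dist (c x) (mat_sqrt d (W x)) \<le> \<delta>"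
    "hs_dist (c x) (mat_sqrt d (W y)) \<le> \<delta>"
    using Cons.prems(1)[of x] Cons.prems(2)[of y] by auto
  have "(1 - 2 * \<delta>\<^sup>2) * (1 - 2 * \<delta>\<^sup>2) ^ length u \<le> Re (mtrace (mat_sqrt d (W x) * mat_sqrt d (W y)))
      * (\<Prod>(x, y)\<leftarrow>zip u v. Re (mtrace (mat_sqrt d (W x) * mat_sqrt d (W y))))"
  proof (rule mult_mono)
    show b: "1 - 2 * \<delta>\<^sup>2 \<le> Re (mtrace (mat_sqrt d (W x) * mat_sqrt d (W y)))"
      by (rule sqrt_overlap_ge[OF xy])
    show "0 \<le> Re (mtrace (mat_sqrt d (W x) * mat_sqrt d (W y)))" using b \<delta> by linarith
    show "(1 - 2 * \<delta>\<^sup>2) ^ length u \<le> (\<Prod>(x, y)\<leftarrow>zip u v. Re (mtrace (mat_sqrt d (W x) * mat_sqrt d (W y))))"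
      using Cons by simp
  qed (use \<delta> in simp)
  then show ?case by simp
qed simp

text \<open>Suppose two codewords round to the same word. By Bernoulli's inequality their overlap is
  at least \<open>1 - 2 * n * \<delta>\<^sup>2\<close>. With weight \<open>s = g / 2\<close> the
  comparison of traces adds at most \<open>g / 2\<close> for the enlarged error of the second kind
  and, by the choice of \<open>\<delta>\<close>, exactly \<open>g / 4\<close> for the distance
  bound. This falls short of the gap \<open>g\<close> between \<open>1 - l1\<close> and
  \<open>l2\<close>.\<close>

lemma DI_code_size_le:
  assumes cq: "cq_channel d X W" and code: "DI_code d X W n N l1 l2 u E"
    and l2: "l2 \<le> 1" and g: "g = 1 - l1 - l2" "0 < g" "g \<le> 1" and n: "0 < n"
    and \<delta>: "\<delta>\<^sup>2 = g\<^sup>2 / (16 * (g + 2) * real n)" "0 < \<delta>" and d: "0 < d"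
  shows "N \<le> covering_number hs_dist (sqrt_tilde d X W) \<delta> ^ n"
proof -
  define F where "F = sqrt_tilde d X W"
  have dens: "density d (W x)" if "x \<in> space X" for x using cq that by (simp add: cq_channel_def)
  have F: "hermitian_mat d M \<and> Re (mtrace (M * M)) \<le> 1" if "M \<in> F" for M
    using that dens mat_sqrt psd_hermitian_mat unfolding F_def sqrt_tilde_def density_def by fastforce
  obtain C where C: "is_cover hs_dist F \<delta> C" "card C = covering_number hs_dist F \<delta>"
    using sqrt_cover_exists[OF F d \<delta>(2)] optimal_cover_exists by blast
  have "\<forall>x\<in>space X. \<exists>c\<in>C. hs_dist c (mat_sqrt d (W x)) \<le> \<delta>"
    using C(1) unfolding is_cover_def F_def sqrt_tilde_def by blast
  then obtain c where c: "\<And>x. x \<in> space X \<Longrightarrow> c x \<in> C \<and> hs_dist (c x) (mat_sqrt d (W x)) \<le> \<delta>"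
    by metis
  have Ch: "hermitian_mat d M" if "M \<in> C" for M using C(1) F that by (auto simp: is_cover_def)
  have u: "set (u j) \<subseteq> space X" "length (u j) = n" "effect (d ^ n) (E j)"
    "1 - l1 \<le> Re (mtrace (tensor_word W (u j) * E j))" if "j < N" for j
    using code that unfolding DI_code_def by auto
  have u2: "Re (mtrace (tensor_word W (u j) * E k)) \<le> l2" if "j < N" "k < N" "j \<noteq> k" for j k
    using code that unfolding DI_code_def by auto
  have \<delta>n: "2 * real n * \<delta>\<^sup>2 = g\<^sup>2 / (8 * (g + 2))" using n g unfolding \<delta>(1) by (simp add: divide_simps)
  have "g\<^sup>2 / (8 * (g + 2)) \<le> 1"
  proof -
    have "g\<^sup>2 \<le> 1" using g by (simp add: power_le_one)
    then show ?thesis using g by (simp add: divide_le_eq)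
  qed
  moreover have "1 * \<delta>\<^sup>2 \<le> real n * \<delta>\<^sup>2" using n by (intro mult_right_mono) auto
  ultimately have \<delta>1: "2 * \<delta>\<^sup>2 \<le> 1" using \<delta>n by linarith
  have "inj_on (\<lambda>j. map c (u j)) {..<N}"
  proof (rule inj_onI, rule ccontr)
    fix j k assume jk: "j \<in> {..<N}" "k \<in> {..<N}" "map c (u j) = map c (u k)" "j \<noteq> k"
    then have j: "j < N" "k < N" by auto
    have len: "length (u j) = length (u k)" using u j by simp
    have p1: "1 - real n * (2 * \<delta>\<^sup>2) \<le> (1 - 2 * \<delta>\<^sup>2) ^ n"
      using Bernoulli_inequality[of "- (2 * \<delta>\<^sup>2)" n] \<delta>1 by simp
    have p2: "(1 - 2 * \<delta>\<^sup>2) ^ length (u j) \<le> (\<Prod>(x, y)\<leftarrow>zip (u j) (u k). Re (mtrace (mat_sqrt d (W x) * mat_sqrt d (W y))))"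
      using u(1)[OF j(1)] u(1)[OF j(2)] dens c Ch by (intro overlap_word_ge[where c = c] len jk(3) \<delta>1) blast+
    have p: "1 - real n * (2 * \<delta>\<^sup>2) \<le> (\<Prod>(x, y)\<leftarrow>zip (u j) (u k). Re (mtrace (mat_sqrt d (W x) * mat_sqrt d (W y))))"
      using p1 p2 u(2)[OF j(1)] by simp
    have "1 - l1 \<le> Re (mtrace (tensor_word W (u j) * E j))" by (rule u(4)[OF j(1)])
    also have "\<dots> \<le> (1 + g / 2) * Re (mtrace (tensor_word W (u k) * E j))
      + (1 + 1 / (g / 2)) * (2 - 2 * (\<Prod>(x, y)\<leftarrow>zip (u j) (u k). Re (mtrace (mat_sqrt d (W x) * mat_sqrt d (W y)))))"
      using u(1,3)[OF j(1)] u(1)[OF j(2)] u(2)[OF j(1)] g len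
      by (intro tensor_word_trace_le dens) auto
    also have "\<dots> \<le> (1 + g / 2) * l2 + (1 + 1 / (g / 2)) * (g\<^sup>2 / (4 * (g + 2)))"
    proof (intro add_mono mult_left_mono)
      show "Re (mtrace (tensor_word W (u k) * E j)) \<le> l2" using u2[OF j(2,1)] jk(4) by simp
      show "2 - 2 * (\<Prod>(x, y)\<leftarrow>zip (u j) (u k). Re (mtrace (mat_sqrt d (W x) * mat_sqrt d (W y)))) \<le> g\<^sup>2 / (4 * (g + 2))"
      proof -
        have "g\<^sup>2 / (4 * (g + 2)) = 2 * (g\<^sup>2 / (8 * (g + 2)))"
          using g by (simp add: divide_simps)
        also have "\<dots> = 2 * (real n * (2 * \<delta>\<^sup>2))" unfolding \<delta>n[symmetric] by simp
        finally have "g\<^sup>2 / (4 * (g + 2)) = 2 * (real n * (2 * \<delta>\<^sup>2))" .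
        then show ?thesis using p by (simp only:)
      qed
    qed (use g in auto)
    also have "(1 + 1 / (g / 2)) * (g\<^sup>2 / (4 * (g + 2))) = g / 4"
    proof -
      have gen: "k / g * (g\<^sup>2 / (4 * k)) = g / 4" if "0 < k" for k
        using that g(2) by (simp add: power2_eq_square)
      have "1 + 1 / (g / 2) = (g + 2) / g" using g(2) by (simp add: field_simps)
      then show ?thesis by (simp only:) (rule gen, use g(2) in simp)
    qed
    also have "(1 + g / 2) * l2 = l2 + g / 2 * l2" by (simp add: algebra_simps)
    also have "g / 2 * l2 \<le> g / 2 * 1" using l2 g by (intro mult_left_mono) auto
    finally show False using g(1,2) by linarith
  qed
  moreover have "(\<lambda>j. map c (u j)) ` {..<N} \<subseteq> words C n" using u c by fastforce
  moreover have finC: "finite C" using C(1) by (simp add: is_cover_def)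
  ultimately have "card {..<N} \<le> card (words C n)" by (intro card_inj_on_le finite_words) auto
  also have "\<dots> = card C ^ n" using finC by (simp add: card_lists_length_eq)
  finally show ?thesis unfolding C(2) F_def by simp
qed

section \<open>Asymptotics\<close>

lemma mult_less_ereal_imp:
  fixes L :: ereal
  assumes "0 < a" "ereal c < ereal a * L"
  shows "ereal (c / a) < L"
  using assms by (cases L) (auto simp: field_simps)

lemma less_mult_ereal_imp:
  fixes L :: ereal
  assumes "0 < a" "ereal a * L < ereal c"
  shows "L < ereal (c / a)"
  using assms by (cases L) (auto simp: field_simps)

text \<open>At a scale \<open>x\<close> with a large covering number the block length is taken as
  the least one allowed, \<open>m x\<close>, the ceiling of \<open>K / x ^ 4\<close>. As
  \<open>x\<close> tends to 0 these lengths tend to infinity, so a strictly smaller upper limit of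
  \<open>r\<close> would be contradicted along them.\<close>

lemma limsup_ge_quarter_dim:
  fixes r :: "nat \<Rightarrow> ereal" and G :: "real \<Rightarrow> nat" and B :: real
  assumes nonneg: "\<And>n. 2 \<le> n \<Longrightarrow> 0 \<le> r n"
    and key: "\<And>t. 0 < t \<Longrightarrow> t < 1 \<Longrightarrow> \<exists>K>0. \<exists>n0. \<forall>n\<ge>n0. \<forall>\<delta>>0. K \<le> \<delta> ^ 4 * real n \<longrightarrow>
      ereal (((1 - t) * log 2 (real (G \<delta>)) - B) / log 2 (real n)) \<le> r n"
  shows "ereal (1/4) * Limsup (at_right 0) (\<lambda>\<delta>. ereal (log 2 (real (G \<delta>)) / (- log 2 \<delta>))) \<le> limsup r"
proof (rule ccontr)
  define L where "L = Limsup (at_right 0) (\<lambda>\<delta>. ereal (log 2 (real (G \<delta>)) / (- log 2 \<delta>)))"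
  assume "\<not> ?thesis"
  then have "limsup r < ereal (1/4) * L" unfolding L_def by (simp add: not_le)
  then obtain c' c where c': "limsup r < ereal c'" and "ereal c' < ereal c" and c: "ereal c < ereal (1/4) * L"
    using ereal_dense2 by metis
  then have cc: "c' < c" by simp
  \<comment> \<open>Nonnegative rates force \<open>c'\<close> to be positive, so that
    \<open>t < 1\<close> and \<open>c'\<close> times a logarithm grows with the block
    length.\<close>
  have "0 \<le> limsup r"
    by (rule le_Limsup) (use nonneg in \<open>auto simp: eventually_at_top_linorder intro!: exI[of _ 2]\<close>)
  with c' have c'0: "0 < c'" by (metis ereal_less(2) le_less_trans)
  have "ereal (4 * c) < L" using mult_less_ereal_imp[OF _ c] by (simp add: mult.commute)
  then have freq: "\<exists>\<^sub>F \<delta> in at_right 0. 4 * c < log 2 (real (G \<delta>)) / (- log 2 \<delta>)"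
    unfolding frequently_def L_def
  proof (rule contrapos_pn)
    assume "\<forall>\<^sub>F \<delta> in at_right 0. \<not> 4 * c < log 2 (real (G \<delta>)) / (- log 2 \<delta>)"
    then have "Limsup (at_right 0) (\<lambda>\<delta>. ereal (log 2 (real (G \<delta>)) / (- log 2 \<delta>))) \<le> ereal (4 * c)"
      by (intro Limsup_bounded) (auto elim!: eventually_mono)
    then show "\<not> ereal (4 * c) < Limsup (at_right 0) (\<lambda>\<delta>. ereal (log 2 (real (G \<delta>)) / (- log 2 \<delta>)))"
      by (simp add: not_less)
  qed
  \<comment> \<open>Chosen so that the loss takes \<open>c\<close> only halfway down to
    \<open>c'\<close>; the rest absorbs \<open>B\<close> and the rounding of the block
    length.\<close>
  define t where "t = (c - c') / (2 * c)"
  have t: "0 < t" "t < 1" using cc c'0 by (auto simp: t_def field_simps)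
  have tc: "(1 - t) * c = (c + c') / 2" using cc c'0 by (simp add: t_def field_simps)
  obtain K n0 where K: "0 < K" and n0: "\<And>n \<delta>. n0 \<le> n \<Longrightarrow> 0 < \<delta> \<Longrightarrow> K \<le> \<delta> ^ 4 * real n \<Longrightarrow>
      ereal (((1 - t) * log 2 (real (G \<delta>)) - B) / log 2 (real n)) \<le> r n"
    using key[OF t] by metis
  define A where "A = (1 - t) * (4 * c)"
  \<comment> \<open>The summand 1 bounds the effect of the ceiling. The denominator grows like
    \<open>4 * (- log 2 x)\<close>, which is the source of the factor 1/4.\<close>
  have lim: "((\<lambda>x::real. (A * (- log 2 x) - B) / log 2 (K / x ^ 4 + 1)) \<longlongrightarrow> A / 4) (at_right 0)"
    using K by real_asymp
  have "c' < A / 4" unfolding A_def using tc cc by simp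
  with lim have ev1: "\<forall>\<^sub>F x in at_right 0. c' < (A * (- log 2 x) - B) / log 2 (K / x ^ 4 + 1)"
    by (rule order_tendstoD(1))
  have ev2: "\<forall>\<^sub>F x::real in at_right 0. 0 < x \<and> x < 1"
    by (simp add: eventually_at_right_less eventually_conj eventually_at_right[of 0 1] exI[of _ 1])
  define m where "m x = nat \<lceil>K / x ^ 4\<rceil>" for x :: real
  have m: "filterlim m sequentially (at_right 0)"
  proof -
    have "filterlim (\<lambda>x::real. K / x ^ 4) at_top (at_right 0)" using K by real_asymp
    then have ev: "\<forall>\<^sub>F x in at_right 0. real Z \<le> K / x ^ 4" for Z
      by (simp add: filterlim_at_top)
    have "\<forall>\<^sub>F x in at_right 0. Z \<le> nat \<lceil>K / x ^ 4\<rceil>" for Z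
      by (rule eventually_mono[OF ev[of Z]]) linarith
    then show ?thesis unfolding filterlim_at_top m_def by blast
  qed
  have ev3: "\<forall>\<^sub>F x in at_right 0. r (m x) < ereal c'"
    by (rule eventually_compose_filterlim[OF Limsup_lessD[OF c'] m])
  have ev4: "\<forall>\<^sub>F x in at_right 0. max n0 2 \<le> m x"
    by (rule eventually_compose_filterlim[OF eventually_ge_at_top m])
  have "\<forall>\<^sub>F x in at_right 0. \<not> 4 * c < log 2 (real (G x)) / (- log 2 x)"
    using ev1 ev2 ev3 ev4
  proof (eventually_elim, intro notI)
    fix x :: real
    assume 1: "c' < (A * (- log 2 x) - B) / log 2 (K / x ^ 4 + 1)" and 2: "0 < x \<and> x < 1"
      and 3: "r (m x) < ereal c'" and 4: "max n0 2 \<le> m x" and f: "4 * c < log 2 (real (G x)) / (- log 2 x)"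
    have lx: "0 < - log 2 x" using 2 by simp
    have mle: "real (m x) \<le> K / x ^ 4 + 1" "K / x ^ 4 \<le> real (m x)"
    proof -
      have "0 < K / x ^ 4" using K 2 by simp
      then show "real (m x) \<le> K / x ^ 4 + 1" "K / x ^ 4 \<le> real (m x)" unfolding m_def by linarith+
    qed
    have lm: "0 < log 2 (real (m x))" using 4 by simp
    have lmle: "log 2 (real (m x)) \<le> log 2 (K / x ^ 4 + 1)" using mle(1) 4 by simp
    have Kx: "K \<le> x ^ 4 * real (m x)" using mle(2) 2 by (simp add: field_simps)
    have "A * (- log 2 x) \<le> (1 - t) * log 2 (real (G x))"
    proof -
      have "4 * c * (- log 2 x) \<le> log 2 (real (G x))" using f lx by (simp add: field_simps)
      then have "(1 - t) * (4 * c * (- log 2 x)) \<le> (1 - t) * log 2 (real (G x))"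
        using t by (intro mult_left_mono) auto
      then show ?thesis by (simp add: A_def)
    qed
    moreover have "0 < log 2 (K / x ^ 4 + 1)" using lm lmle by linarith
    then have num: "c' * log 2 (K / x ^ 4 + 1) < A * (- log 2 x) - B" using 1 by (simp add: field_simps)
    moreover have "c' * log 2 (real (m x)) \<le> c' * log 2 (K / x ^ 4 + 1)"
      using lmle c'0 by (intro mult_left_mono) auto
    ultimately have "c' * log 2 (real (m x)) \<le> (1 - t) * log 2 (real (G x)) - B" by linarith
    then have "c' \<le> ((1 - t) * log 2 (real (G x)) - B) / log 2 (real (m x))"
      using lm by (simp add: field_simps)
    moreover have "ereal (((1 - t) * log 2 (real (G x)) - B) / log 2 (real (m x))) \<le> r (m x)"
      using n0 4 2 Kx by simp
    ultimately show False using 3 by (metis ereal_less_eq(3) leD order_trans)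
  qed
  with freq show False unfolding frequently_def by blast
qed

text \<open>An eventual upper bound on covering numbers holds along every sequence of scales tending
  to 0, in particular along \<open>sqrt (\<kappa> / n)\<close>, where
  \<open>- log 2 \<delta>\<close> is half of \<open>log 2 n\<close> up to a constant.\<close>

lemma limsup_le_half_dim:
  fixes r :: "nat \<Rightarrow> ereal" and G :: "real \<Rightarrow> nat"
  assumes \<kappa>: "0 < \<kappa>"
    and le: "\<And>n. 2 \<le> n \<Longrightarrow> r n \<le> ereal (log 2 (real (G (sqrt (\<kappa> / real n)))) / log 2 (real n))"
  shows "limsup r \<le> ereal (1/2) * Limsup (at_right 0) (\<lambda>\<delta>. ereal (log 2 (real (G \<delta>)) / (- log 2 \<delta>)))"
proof (rule dense_ge)
  define L where "L = Limsup (at_right 0) (\<lambda>\<delta>. ereal (log 2 (real (G \<delta>)) / (- log 2 \<delta>)))"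
  fix x assume "ereal (1/2) * Limsup (at_right 0) (\<lambda>\<delta>. ereal (log 2 (real (G \<delta>)) / (- log 2 \<delta>))) < x"
  then obtain c where c: "ereal (1/2) * L < ereal c" "ereal c < x" using ereal_dense2 unfolding L_def by blast
  have "L < ereal (2 * c)" using less_mult_ereal_imp[OF _ c(1)] by (simp add: mult.commute)
  then have "\<forall>\<^sub>F \<delta> in at_right 0. ereal (log 2 (real (G \<delta>)) / (- log 2 \<delta>)) < ereal (2 * c)"
    unfolding L_def by (rule Limsup_lessD)
  moreover have "filterlim (\<lambda>n. sqrt (\<kappa> / real n)) (at_right 0) sequentially" using \<kappa> by real_asymp
  ultimately have ev1: "\<forall>\<^sub>F n in sequentially. ereal (log 2 (real (G (sqrt (\<kappa> / real n)))) / (- log 2 (sqrt (\<kappa> / real n)))) < ereal (2 * c)"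
    by (rule eventually_compose_filterlim)
  have "(\<lambda>n. 2 * c * (- log 2 (sqrt (\<kappa> / real n))) / log 2 (real n)) \<longlonglongrightarrow> c" using \<kappa> by real_asymp
  then have "(\<lambda>n. ereal (2 * c * (- log 2 (sqrt (\<kappa> / real n))) / log 2 (real n))) \<longlonglongrightarrow> ereal c" by simp
  then have ev2: "\<forall>\<^sub>F n in sequentially. ereal (2 * c * (- log 2 (sqrt (\<kappa> / real n))) / log 2 (real n)) < x"
    using c(2) by (rule order_tendstoD(2))
  have ev3: "\<forall>\<^sub>F n in sequentially. 2 \<le> n \<and> \<kappa> < real n"
    using eventually_ge_at_top[of 2] eventually_gt_at_top[of "nat \<lceil>\<kappa>\<rceil>"]
    by eventually_elim linarith
  show "limsup r \<le> x"
  proof (rule Limsup_bounded, use ev1 ev2 ev3 in eventually_elim)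
    fix n :: nat
    define D where "D = sqrt (\<kappa> / real n)"
    assume 1: "ereal (log 2 (real (G (sqrt (\<kappa> / real n)))) / (- log 2 (sqrt (\<kappa> / real n)))) < ereal (2 * c)"
      and 2: "ereal (2 * c * (- log 2 (sqrt (\<kappa> / real n))) / log 2 (real n)) < x" and 3: "2 \<le> n \<and> \<kappa> < real n"
    have "0 < D" "D < 1" using 3 \<kappa> by (auto simp: D_def)
    then have "0 < - log 2 D" by simp
    moreover have "log 2 (real (G D)) / (- log 2 D) < 2 * c" using 1 unfolding D_def[symmetric] by simp
    ultimately have "log 2 (real (G D)) \<le> 2 * c * (- log 2 D)" by (simp add: field_simps)
    moreover have "0 < log 2 (real n)" using 3 by simp
    ultimately have "log 2 (real (G D)) / log 2 (real n) \<le> 2 * c * (- log 2 D) / log 2 (real n)"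
      by (intro divide_right_mono) auto
    then have "r n \<le> ereal (2 * c * (- log 2 D) / log 2 (real n))"
      using le[of n] 3 unfolding D_def[symmetric] by (meson ereal_less_eq(3) order_trans)
    with 2 show "r n \<le> x" unfolding D_def[symmetric] by simp
  qed
qed

lemma elog2_mono: "x \<le> y \<Longrightarrow> elog2 x \<le> elog2 y"
  by (cases x; cases y) (auto simp: elog2_def)

lemma elog2_real: "0 < x \<Longrightarrow> elog2 (ereal x) = ereal (log 2 x)"
  by (simp add: elog2_def)

text \<open>The denominator of \<open>rate\<close> is 0 for \<open>n = 0\<close> and
  \<open>n = 1\<close>, so all estimates of rates start at 2.\<close>

lemma rate_mono:
  assumes "2 \<le> n" "M \<le> N"
  shows "rate n M \<le> rate n N"
  unfolding rate_def using assms by (intro ereal_divide_right_mono elog2_mono) auto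

lemma rate_real: "2 \<le> n \<Longrightarrow> 0 < x \<Longrightarrow> rate n (ereal x) = ereal (log 2 x / (real n * log 2 (real n)))"
  using zero_less_log_cancel_iff[of 2 "real n"] by (simp add: rate_def elog2_real del: zero_less_log_cancel_iff)

section \<open>Rates of the constructed codes and the chain of inequalities\<close>

context cq_measured
begin

text \<open>A single constant word with the decoder that accepts everything is a code.\<close>

lemma rate_sim_nonneg:
  assumes "space X \<noteq> {}" "0 < l1" "2 \<le> n"
  shows "0 \<le> rate n (N_DI_sim d X W n l1 l2)"
proof -
  obtain x where x: "x \<in> space X" using assms by blast
  let ?u = "replicate n x"
  have "ereal (real (card {?u})) \<le> N_DI_sim d X W n l1 l2"
    using x assms word_prob_sum[of ?u] by (intro simultaneous_code[where Z = "\<lambda>_. words UNIV n"]) auto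
  then have "rate n (ereal 1) \<le> rate n (N_DI_sim d X W n l1 l2)"
    using assms by (intro rate_mono) auto
  then show ?thesis using assms rate_real[of n 1] by (simp add: zero_ereal_def)
qed

text \<open>Comparing logarithms lets a singleton serve, by \<open>log 2 0 = 0\<close>, in case the covering number is \<open>0\<close>,
  so that no finiteness of covers is needed here.\<close>

lemma hat_packing:
  assumes "space X \<noteq> {}" "0 < \<delta>"
  shows "\<exists>A. finite A \<and> A \<noteq> {} \<and> A \<subseteq> space X
     \<and> log 2 (real (card A)) = log 2 (real (covering_number dist (sqrt_hat X W T) \<delta>))
     \<and> (\<forall>x\<in>A. \<forall>x'\<in>A. x \<noteq> x' \<longrightarrow> \<delta>\<^sup>2 \<le> (\<Sum>y\<in>UNIV. (sqrt (output_prob W T x y) - sqrt (output_prob W T x' y))\<^sup>2))"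
proof -
  define F where "F = sqrt_hat X W T"
  define h where "h x = (\<chi> y. sqrt (Re (mtrace (W x * T y))))" for x
  have F: "F = h ` space X" by (simp add: F_def sqrt_hat_def h_def)
  obtain A' where A': "A' \<subseteq> F" "finite A'" "card A' = covering_number dist F \<delta>"
    "\<forall>x\<in>A'. \<forall>y\<in>A'. x \<noteq> y \<longrightarrow> \<delta> < dist x y"
    using packing_exists[of "covering_number dist F \<delta>" dist F \<delta>] assms by (auto simp: dist_commute)
  obtain A where A: "A \<subseteq> space X" "inj_on h A" "A' = h ` A"
    using A'(1) unfolding F by (auto simp: subset_image_inj)
  have sep: "\<delta>\<^sup>2 \<le> (\<Sum>y\<in>UNIV. (sqrt (output_prob W T x y) - sqrt (output_prob W T x' y))\<^sup>2)"
    if "x \<in> A" "x' \<in> A" "x \<noteq> x'" for x x'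
  proof -
    have "h x \<noteq> h x'" using that A(2) by (auto simp: inj_on_def)
    then have "\<delta> < dist (h x) (h x')" using that A(3) A'(4) by blast
    then have "\<delta>\<^sup>2 \<le> (dist (h x) (h x'))\<^sup>2" using assms by (intro power_mono) auto
    also have "\<dots> = (\<Sum>y\<in>UNIV. (sqrt (output_prob W T x y) - sqrt (output_prob W T x' y))\<^sup>2)"
      by (simp add: dist_vec_def L2_set_def h_def output_prob_def sum_nonneg dist_real_def)
    finally show ?thesis .
  qed
  have cA: "card A = card A'" "finite A" using A A' by (auto simp: card_image finite_image_iff)
  show ?thesis
  proof (cases "A = {}")
    case False
    then show ?thesis using A cA A'(3) sep unfolding F_def by (intro exI[of _ A]) auto
  next
    case True
    obtain x where "x \<in> space X" using assms by blast
    moreover have "covering_number dist (sqrt_hat X W T) \<delta> = 0" using True cA A'(3) by (simp add: F_def)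
    ultimately show ?thesis by (intro exI[of _ "{x}"]) (auto simp: log_def)
  qed
qed

text \<open>The counting bound in logarithmic form: \<open>2 ^ n\<close> costs one bit per letter,
  and since \<open>ln 2\<close> is at least 1/2, the entropy selection costs at most
  \<open>2 * c\<close> bits per letter.\<close>

lemma log_card_words_ge:
  assumes n: "0 < n" and q: "1 \<le> q"
    and le: "q ^ n \<le> (real n * c + 1) * (k * (2 ^ n * q powr (t * real n)))" and c: "0 \<le> c"
  shows "0 < k" "real n * ((1 - t) * log 2 q - (1 + 2 * c)) \<le> log 2 k"
proof -
  have pos: "0 < q ^ n" "0 < real n * c + 1" "0 < 2 ^ n * q powr (t * real n)" using q c by (auto simp: add_nonneg_pos)
  then have "0 < (real n * c + 1) * (k * (2 ^ n * q powr (t * real n)))" using le by linarith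
  then show k: "0 < k" using pos by (auto simp: zero_less_mult_iff)
  have "log 2 (q ^ n) \<le> log 2 ((real n * c + 1) * (k * (2 ^ n * q powr (t * real n))))"
    using le pos k by simp
  also have "\<dots> = log 2 (real n * c + 1) + (log 2 k + (real n + t * real n * log 2 q))"
    using pos k q by (simp add: log_mult log_powr log_nat_power)
  also have "log 2 (real n * c + 1) \<le> real n * (2 * c)"
  proof -
    have "ln (real n * c + 1) \<le> real n * c" using ln_add_one_self_le_self[of "real n * c"] c by (simp add: add.commute)
    moreover have "1 / 2 \<le> ln (2 :: real)" using ln2_ge_two_thirds by simp
    ultimately have "ln (real n * c + 1) \<le> 2 * (real n * c) * ln 2"
      using mult_left_mono[of "1/2" "ln 2" "2 * (real n * c)"] c by simp
    then show ?thesis unfolding log_def by (simp add: field_simps)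
  qed
  finally show "real n * ((1 - t) * log 2 q - (1 + 2 * c)) \<le> log 2 k"
    using q by (simp add: log_nat_power algebra_simps)
qed

lemma rate_sim_ge:
  assumes ne: "space X \<noteq> {}" and l: "0 < l1" "0 < l2" and t: "0 < t" "t < 1"
  shows "\<exists>K>0. \<exists>n0. \<forall>n\<ge>n0. \<forall>\<delta>>0. K \<le> \<delta> ^ 4 * real n \<longrightarrow>
      ereal (((1 - t) * log 2 (real (covering_number dist (sqrt_hat X W T) \<delta>)) - (1 + 2 * real CARD('y))) / log 2 (real n))
      \<le> rate n (N_DI_sim d X W n l1 l2)"
proof -
  \<comment> \<open>The error of the second kind is split in halves, one for Chebyshev and one for
    the fidelity term; with radius \<open>a = k * sqrt n\<close> the Chebyshev bound is exactly
    \<open>m\<close>.\<close>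
  define m where "m = min l1 (l2 / 2)"
  define k where "k = sqrt (4 * real CARD('y) / m)"
  have m: "0 < m" "m \<le> l1" "m \<le> l2 / 2" using l by (auto simp: m_def)
  have k: "0 < k" "4 * real CARD('y) / k\<^sup>2 = m" using m by (auto simp: k_def)
  \<comment> \<open>Makes the exponent of the fidelity at least \<open>(k + 1) * sqrt n\<close>. The
    part \<open>k * sqrt n\<close> cancels the radius \<open>a\<close>, and \<open>n0\<close>
    ensures that the spare \<open>sqrt n\<close> covers the constant
    \<open>1/2 - ln (l2 / 2)\<close>.\<close>
  define K where "K = (2 * (k + 1) / t)\<^sup>2"
  define n0 where "n0 = max 2 (nat \<lceil>(1/2 - ln (l2 / 2))\<^sup>2\<rceil>)"
  show ?thesis
  proof (intro exI[of _ K] conjI exI[of _ n0] allI impI)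
    show "0 < K" using k t by (auto simp: K_def intro!: divide_pos_pos)
    fix n \<delta> assume n: "n0 \<le> n" and \<delta>: "0 < (\<delta> :: real)" and Kn: "K \<le> \<delta> ^ 4 * real n"
    have n2: "2 \<le> n" "(1/2 - ln (l2 / 2))\<^sup>2 \<le> real n" using n unfolding n0_def by linarith+
    obtain A where A: "finite A" "A \<noteq> {}" "A \<subseteq> space X"
      "log 2 (real (card A)) = log 2 (real (covering_number dist (sqrt_hat X W T) \<delta>))"
      and sep: "\<forall>x\<in>A. \<forall>x'\<in>A. x \<noteq> x' \<longrightarrow> \<delta>\<^sup>2 \<le> (\<Sum>y\<in>UNIV. (sqrt (output_prob W T x y) - sqrt (output_prob W T x' y))\<^sup>2)"
      using hat_packing[OF ne \<delta>] by (elim exE conjE) (rule that)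
    define a where "a = k * sqrt (real n)"
    have a: "0 < a" "4 * CARD('y) * real n / a\<^sup>2 = m"
      using k n2 by (auto simp: a_def power_mult_distrib)
    have expo: "exp (1/2 + a - \<delta>\<^sup>2 / 2 * t * real n) \<le> l2 / 2"
    proof -
      have "2 * (k + 1) / t * sqrt (real n) \<le> \<delta>\<^sup>2 * real n"
      proof (rule power2_le_imp_le)
        have "(2 * (k + 1) / t * sqrt (real n))\<^sup>2 = K * real n"
          unfolding K_def power_mult_distrib[of "2 * (k + 1) / t" "sqrt (real n)"] by simp
        also have "\<dots> \<le> \<delta> ^ 4 * real n * real n" using Kn by (intro mult_right_mono) auto
        also have "\<dots> = (\<delta>\<^sup>2 * real n)\<^sup>2" by (simp add: power2_eq_square power4_eq_xxxx)
        finally show "(2 * (k + 1) / t * sqrt (real n))\<^sup>2 \<le> (\<delta>\<^sup>2 * real n)\<^sup>2" .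
      qed simp
      then have "(k + 1) * sqrt (real n) \<le> \<delta>\<^sup>2 / 2 * t * real n" using t by (simp add: field_simps)
      moreover have "1/2 - ln (l2 / 2) \<le> sqrt (real n)" using n2(2) real_le_rsqrt by blast
      ultimately have "1/2 + a - \<delta>\<^sup>2 / 2 * t * real n \<le> ln (l2 / 2)" by (simp add: a_def algebra_simps)
      then show ?thesis using l by (metis exp_le_cancel_iff exp_ln half_gt_zero)
    qed
    obtain C where C: "C \<subseteq> words A n"
      and card: "real (card A) ^ n \<le> (real n * CARD('y) + 1) * (real (card C) * (2 ^ n * real (card A) powr (t * real n)))"
      and e1: "\<forall>u\<in>C. 1 - 4 * CARD('y) * real n / a\<^sup>2 \<le> (\<Sum>ys\<in>typical_set a u. word_prob u ys)"
      and e2: "\<forall>u\<in>C. \<forall>v\<in>C. u \<noteq> v \<longrightarrow> (\<Sum>ys\<in>typical_set a u. word_prob v ys)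
         \<le> 4 * CARD('y) * real n / a\<^sup>2 + exp (1/2 + a - \<delta>\<^sup>2 / 2 * t * real n)"
      using code_exists[OF A(1-3) t(1) a(1) zero_le_power2 sep, of n]
      by (elim exE conjE) (rule that)
    have N: "ereal (real (card C)) \<le> N_DI_sim d X W n l1 l2"
    proof (rule simultaneous_code[where Z = "typical_set a"])
      show "C \<subseteq> words (space X) n" "finite C"
        using C A(3) finite_subset[OF C finite_words[OF A(1)]] by blast+
      show "typical_set a u \<subseteq> words UNIV n" if "u \<in> C" for u using C that by (auto simp: typical_set_def)
      show "1 - l1 \<le> (\<Sum>ys\<in>typical_set a u. word_prob u ys)" if "u \<in> C" for u
        using bspec[OF e1 that] m(2) unfolding a(2) by linarith
      show "(\<Sum>ys\<in>typical_set a u. word_prob v ys) \<le> l2" if "u \<in> C" "v \<in> C" "u \<noteq> v" for u v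
        using e2[rule_format, OF that] m(3) expo unfolding a(2) by linarith
    qed
    have q: "1 \<le> real (card A)" using A by (simp add: Suc_le_eq card_gt_0_iff)
    have "0 < n" using n2 by simp
    note lc = log_card_words_ge[OF this q card]
    have "((1 - t) * log 2 (real (card A)) - (1 + 2 * real CARD('y))) / log 2 (real n)
        = real n * ((1 - t) * log 2 (real (card A)) - (1 + 2 * real CARD('y))) / (real n * log 2 (real n))"
      using n2 by simp
    also have "\<dots> \<le> log 2 (real (card C)) / (real n * log 2 (real n))"
      using n2 lc(2) by (intro divide_right_mono) auto
    finally have "ereal (((1 - t) * log 2 (real (card A)) - (1 + 2 * real CARD('y))) / log 2 (real n))
        \<le> rate n (ereal (real (card C)))"
      using rate_real[OF n2(1) lc(1)] by simp
    also have "\<dots> \<le> rate n (N_DI_sim d X W n l1 l2)" by (rule rate_mono[OF n2(1) N])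
    finally show "ereal (((1 - t) * log 2 (real (covering_number dist (sqrt_hat X W T) \<delta>)) - (1 + 2 * real CARD('y))) / log 2 (real n))
      \<le> rate n (N_DI_sim d X W n l1 l2)" unfolding A(4) .
  qed
qed

lemma dim_le_sim_opt:
  assumes "space X \<noteq> {}"
  shows "ereal (1/4) * upper_minkowski_dim dist (sqrt_hat X W T) \<le> C_DI_sim_opt d X W"
  unfolding C_DI_sim_opt_def upper_minkowski_dim_def
  by (intro INF_greatest limsup_ge_quarter_dim[OF _ rate_sim_ge[OF assms]] rate_sim_nonneg[OF assms]) auto

end

lemma sim_opt_le_DI:
  assumes "0 < l1" "0 < l2"
  shows "C_DI_sim_opt d X W \<le> limsup (\<lambda>n. rate n (N_DI d X W n l1 l2))"
proof -
  have "C_DI_sim_opt d X W \<le> limsup (\<lambda>n. rate n (N_DI_sim d X W n l1 l2))"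
    unfolding C_DI_sim_opt_def using assms by (intro INF_lower2[of l1] INF_lower2[of l2]) auto
  also have "\<dots> \<le> limsup (\<lambda>n. rate n (N_DI d X W n l1 l2))"
  proof (rule Limsup_mono, rule eventually_mono[OF eventually_ge_at_top[of 2]])
    fix n :: nat assume "2 \<le> n"
    then show "rate n (N_DI_sim d X W n l1 l2) \<le> rate n (N_DI d X W n l1 l2)"
      unfolding N_DI_sim_def N_DI_def by (intro rate_mono SUP_subset_mono) auto
  qed
  finally show ?thesis .
qed

lemma DI_le_dim:
  assumes cq: "cq_channel d X W" and ne: "space X \<noteq> {}"
    and l: "0 < l1" "0 < l2" "l1 + l2 < 1"
  shows "limsup (\<lambda>n. rate n (N_DI d X W n l1 l2)) \<le> ereal (1/2) * upper_minkowski_dim hs_dist (sqrt_tilde d X W)"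
proof -
  define g \<kappa> where "g = 1 - l1 - l2" and "\<kappa> = g\<^sup>2 / (16 * (g + 2))"
  have g: "0 < g" "g \<le> 1" using l by (auto simp: g_def)
  then have \<kappa>: "0 < \<kappa>" by (simp add: \<kappa>_def)
  obtain x where x: "x \<in> space X" using ne by blast
  then have "density d (W x)" using cq by (simp add: cq_channel_def)
  \<comment> \<open>In dimension 0 every trace is 0, so there are no states.\<close>
  then have d: "0 < d" by (cases "d = 0") (auto simp: density_def psd_def mtrace_def)
  let ?G = "covering_number hs_dist (sqrt_tilde d X W)"
  show ?thesis
    unfolding upper_minkowski_dim_def
  proof (rule limsup_le_half_dim[OF \<kappa>])
    fix n :: nat assume n: "2 \<le> n"
    define \<delta> where "\<delta> = sqrt (\<kappa> / real n)"
    have \<delta>: "0 < \<delta>" "\<delta>\<^sup>2 = \<kappa> / real n" using \<kappa> n by (auto simp: \<delta>_def)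
    then have \<delta>2: "\<delta>\<^sup>2 = g\<^sup>2 / (16 * (g + 2) * real n)" by (simp add: \<kappa>_def)
    have size: "N \<le> ?G \<delta> ^ n" if "DI_code d X W n N l1 l2 u E" for N u E
      using DI_code_size_le[OF cq that _ g_def g _ \<delta>2 \<delta>(1) d] l n by simp
    \<comment> \<open>A code with one word forces the covering number to be positive, so its
      logarithm below is not a default value.\<close>
    have "DI_code d X W n 1 l1 l2 (\<lambda>_. replicate n x) (\<lambda>_. 1\<^sub>m (d ^ n))"
    proof -
      have "tensor_word W (replicate n x) \<in> carrier_mat (d ^ n) (d ^ n)"
        using tensor_word_carrier[of "replicate n x" W d] \<open>density d (W x)\<close> by (auto simp: density_def psd_def)
      moreover have "mtrace (tensor_word W (replicate n x)) = 1"
        using mtrace_tensor_word[of "replicate n x" W d] \<open>density d (W x)\<close> by (auto simp: density_def psd_def)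
      ultimately show ?thesis
        unfolding DI_code_def using x l by (auto simp: effect_iff psd_one inner_vec_apply_mat_one)
    qed
    from size[OF this] have G: "0 < ?G \<delta>" using n by (cases "?G \<delta> = 0") (auto simp: zero_power)
    have "N_DI d X W n l1 l2 \<le> ereal (real (?G \<delta> ^ n))"
      unfolding N_DI_def using size by (intro SUP_least) (auto simp del: of_nat_power)
    then have "rate n (N_DI d X W n l1 l2) \<le> rate n (ereal (real (?G \<delta> ^ n)))"
      by (rule rate_mono[OF n])
    also have "\<dots> = ereal (log 2 (real (?G \<delta>)) / log 2 (real n))"
      using rate_real[OF n, of "real (?G \<delta> ^ n)"] G n by (simp add: log_nat_power)
    finally show "rate n (N_DI d X W n l1 l2) \<le> ereal (log 2 (real (?G (sqrt (\<kappa> / real n)))) / log 2 (real n))"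
      unfolding \<delta>_def .
  qed
qed

theorem theorem14:
  fixes d :: nat and X :: "'x measure" and W :: "'x \<Rightarrow> complex mat"
    and T :: "'y::finite \<Rightarrow> complex mat" and l1 l2 :: real
  assumes "cq_channel d X W"
    and "space X \<noteq> {}"
    and "informationally_complete d (UNIV :: 'y set) T"
    and "CARD('y) \<ge> d ^ 2"
    and "l1 > 0" and "l2 > 0" and "l1 + l2 < 1"
  shows "ereal (1/4) * upper_minkowski_dim dist (sqrt_hat X W T) \<le> C_DI_sim_opt d X W
     \<and> C_DI_sim_opt d X W \<le> limsup (\<lambda>n. rate n (N_DI d X W n l1 l2))
     \<and> limsup (\<lambda>n. rate n (N_DI d X W n l1 l2)) \<le> ereal (1/2) * upper_minkowski_dim hs_dist (sqrt_tilde d X W)"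
proof (intro conjI)
  interpret cq_measured d X W T
    using assms by unfold_locales (auto simp: informationally_complete_def)
  show "ereal (1/4) * upper_minkowski_dim dist (sqrt_hat X W T) \<le> C_DI_sim_opt d X W"
    using assms by (intro dim_le_sim_opt)
qed (use assms in \<open>auto intro: sim_opt_le_DI DI_le_dim\<close>)

end
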